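(* Let $X$ be a nonzero complex Banach space with open unit ball $\mathbb{B}$. Let $\beta_0=(8+\sqrt{346})/47\approx0.56598$, which is a root of $47\beta^2-16\beta-6=0$, and let $\beta\in[\beta_0,1]$. Let $f:\mathbb{B}\to\mathbb{C}$ be holomorphic with $f(0)=1$ and suppose $F(z)=zf(z)$ belongs to $\mathcal{SS}^*_\beta(\mathbb{B})$. Then for every $z\in X\setminus\{0\}$ and $l_z\in T(z)$, $$\left|A_2^3-2A_2A_3^2-A_2A_4^2+2A_3^2A_4\right|\le\frac4{81}\beta^3(17\beta^2+10)(47\beta^2+16),$$ where $$A_2=\frac{l_z(D^2F(0)(z^2))}{2!\,\|z\|^2},\quad A_3=\frac{l_z(D^3F(0)(z^3))}{3!\,\|z\|^3},\quad A_4=\frac{l_z(D^4F(0)(z^4))}{4!\,\|z\|^4}.$$ The estimate is sharp.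
   Context: For $z\in X\setminus\{0\}$, $T(z)=\{l_z\in L(X,\mathbb{C}): l_z(z)=\|z\|,\ \|l_z\|=1\}$, where $L(X,\mathbb{C})$ is the space of continuous linear functionals on $X$. $D^nF(0)$ is the $n$-th Fréchet derivative at $0$ and $D^nF(0)(z^n)=D^nF(0)(z,\dots,z)$. A holomorphic mapping $F:\mathbb{B}\to X$ is normalized if $F(0)=0$ and $DF(0)=I$, and locally biholomorphic if $DF(z)$ is invertible with bounded inverse for each $z\in\mathbb{B}$. For $\beta\in(0,1]$, $\mathcal{SS}^*_\beta(\mathbb{B})$ (strongly starlike mappings of order $\beta$) is the class of normalized locally biholomorphic $F$ with $$\left|\arg l_z([DF(z)]^{-1}F(z))\right|<\frac\pi2\beta\quad\text{for all }z\in\mathbb{B}\setminus\{0\},\ l_z\in T(z)$$ (in particular $l_z([DF(z)]^{-1}F(z))\ne0$). Equivalently, $\dfrac{\|z\|}{l_z([DF(z)]^{-1}F(z))}\in\Phi(\mathbb{U})$ for all such $z,l_z$, where $\mathbb{U}$ is the open unit disk and $\Phi(\zeta)=\left(\frac{1+\zeta}{1-\zeta}\right)^\beta$ with the branch equal to $1$ at $\zeta=0$. "Sharp" means: for each such $X$ and $\beta$ there exist an $f$ satisfying the hypotheses and a $z\in X\setminus\{0\}$, $l_z\in T(z)$ for which equality holds. *)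

theory Defs
  imports "HOL-Analysis.Analysis"
begin

class scaleC =
  fixes scaleC :: "complex \<Rightarrow> 'a \<Rightarrow> 'a"  (infixr \<open>*\<^sub>C\<close> 75)

class complex_vector = scaleC + real_vector +
  assumes scaleC_add_right: "a *\<^sub>C (x + y) = a *\<^sub>C x + a *\<^sub>C y"
    and scaleC_add_left: "(a + b) *\<^sub>C x = a *\<^sub>C x + b *\<^sub>C x"
    and scaleC_scaleC: "a *\<^sub>C b *\<^sub>C x = (a * b) *\<^sub>C x"
    and scaleC_one: "1 *\<^sub>C x = x"
    and scaleR_eq_scaleC: "r *\<^sub>R x = complex_of_real r *\<^sub>C x"

class complex_normed_vector = complex_vector + real_normed_vector +
  assumes norm_scaleC: "norm (a *\<^sub>C x) = cmod a * norm x"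

class complex_banach = complex_normed_vector + complete_space

subclass (in complex_banach) banach ..

instantiation complex :: complex_banach
begin

definition scaleC_complex :: "complex \<Rightarrow> complex \<Rightarrow> complex" where
  "scaleC_complex a x = a * x"

instance
  by standard
    (auto simp: scaleC_complex_def algebra_simps norm_mult scaleR_conv_of_real)

end

definition bounded_clinear :: "('a::complex_normed_vector \<Rightarrow> 'b::complex_normed_vector) \<Rightarrow> bool" where
  "bounded_clinear g \<longleftrightarrow> bounded_linear g \<and> (\<forall>c x. g (c *\<^sub>C x) = c *\<^sub>C g x)"

text \<open>Holomorphy on an open set: existence of a complex-linear Frechet derivative at every point.\<close>

definition fholomorphic_on ::
    "('a::complex_normed_vector \<Rightarrow> 'b::complex_normed_vector) \<Rightarrow> 'a set \<Rightarrow> bool" where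
  "fholomorphic_on f S \<longleftrightarrow> (\<forall>z\<in>S. \<exists>D. bounded_clinear D \<and> (f has_derivative D) (at z))"

text \<open>
  The Frechet derivative as an element of the Banach space of bounded operators, so that iterating
  \<open>fderiv\<close> gives the higher derivatives. Operators of type \<open>'a \<Rightarrow>\<^sub>L 'b\<close> are real-linear, but
  Frechet derivatives are unique: for a complex differentiable map this is the complex derivative.
\<close>

definition fderiv ::
    "('a::real_normed_vector \<Rightarrow> 'b::real_normed_vector) \<Rightarrow> 'a \<Rightarrow> ('a \<Rightarrow>\<^sub>L 'b)" where
  "fderiv f z = Blinfun (frechet_derivative f (at z))"

definition support_functionals :: "'a::complex_normed_vector \<Rightarrow> ('a \<Rightarrow> complex) set" where
  "support_functionals z =
     {l. bounded_clinear l \<and> l z = complex_of_real (norm z) \<and> onorm l = 1}"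

definition normalized :: "('a::complex_normed_vector \<Rightarrow> 'a) \<Rightarrow> bool" where
  "normalized F \<longleftrightarrow> F 0 = 0 \<and> fderiv F 0 = id_blinfun"

definition locally_biholomorphic :: "('a::complex_normed_vector \<Rightarrow> 'a) \<Rightarrow> bool" where
  "locally_biholomorphic F \<longleftrightarrow>
     (\<forall>z\<in>ball 0 1. \<exists>G. G o\<^sub>L fderiv F z = id_blinfun \<and> fderiv F z o\<^sub>L G = id_blinfun)"

text \<open>
  Mappings of the open unit ball are total functions here; their values outside the ball are
  irrelevant. The condition \<open>w \<noteq> 0\<close> is explicit because \<open>Arg 0 = 0\<close> in the library.
\<close>

definition strongly_starlike :: "real \<Rightarrow> ('a::complex_normed_vector \<Rightarrow> 'a) set" where
  "strongly_starlike \<beta> =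
     {F. fholomorphic_on F (ball 0 1) \<and> normalized F \<and> locally_biholomorphic F \<and>
         (\<forall>z\<in>ball 0 1 - {0}. \<forall>l\<in>support_functionals z.
            let w = l (inv (blinfun_apply (fderiv F z)) (F z))
            in w \<noteq> 0 \<and> \<bar>Arg w\<bar> < pi / 2 * \<beta>)}"

definition A2 :: "('a::complex_normed_vector \<Rightarrow> 'a) \<Rightarrow> 'a \<Rightarrow> ('a \<Rightarrow> complex) \<Rightarrow> complex" where
  "A2 F z l = l (fderiv (fderiv F) 0 z z) / (fact 2 * of_real (norm z) ^ 2)"

definition A3 :: "('a::complex_normed_vector \<Rightarrow> 'a) \<Rightarrow> 'a \<Rightarrow> ('a \<Rightarrow> complex) \<Rightarrow> complex" where
  "A3 F z l = l (fderiv (fderiv (fderiv F)) 0 z z z) / (fact 3 * of_real (norm z) ^ 3)"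

definition A4 :: "('a::complex_normed_vector \<Rightarrow> 'a) \<Rightarrow> 'a \<Rightarrow> ('a \<Rightarrow> complex) \<Rightarrow> complex" where
  "A4 F z l = l (fderiv (fderiv (fderiv (fderiv F))) 0 z z z z) / (fact 4 * of_real (norm z) ^ 4)"

definition coeff_expr :: "('a::complex_normed_vector \<Rightarrow> 'a) \<Rightarrow> 'a \<Rightarrow> ('a \<Rightarrow> complex) \<Rightarrow> complex" where
  "coeff_expr F z l =
     A2 F z l ^ 3 - 2 * A2 F z l * A3 F z l ^ 2 - A2 F z l * A4 F z l ^ 2 + 2 * A3 F z l ^ 2 * A4 F z l"

end

theory Submission
  imports Defs "HOL-Complex_Analysis.Complex_Analysis"
begin

text \<open>
  Everything happens on one complex line. For \<open>F z = f z *\<^sub>C z\<close> the derivative \<open>DF(z)\<close> maps \<open>z\<close> to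
  \<open>(f z + Df(z) z) *\<^sub>C z\<close>, so \<open>[DF(z)]\<^sup>-\<^sup>1 F(z)\<close> is a scalar multiple of \<open>z\<close>, and every support functional
  of \<open>z\<close> takes the value \<open>norm z * f z / (f z + Df(z) z)\<close> there. With \<open>norm u = 1\<close> and \<open>\<psi> t = f (t *\<^sub>C u)\<close>,
  the starlikeness of \<open>F\<close> thus says that \<open>p = (\<psi> + t \<psi>') / \<psi>\<close> maps the unit disc into the sector
  \<open>\<bar>arg\<bar> < \<pi>\<beta>/2\<close>, which means that \<open>t \<psi>(t)\<close> is a strongly starlike function of order \<open>\<beta>\<close> of one variable
  (\<open>strongly_starlike_scalar_iff\<close>). The numbers \<open>A\<^sub>2, A\<^sub>3, A\<^sub>4\<close> are its Taylor coefficients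
  (\<open>Frechet_coeffs_eq_fps_coeffs\<close>).

  That last identification needs a holomorphic map, which is assumed to be differentiable just once, to have
  derivatives of all orders. This is \<open>fholomorphic_fderiv\<close>: the Frechet derivative of a holomorphic map is
  a holomorphic map into the Banach space of bounded operators. It rests on a criterion of
  Graves--Taylor--Hille--Zorn type (\<open>weakly_holomorphic_imp_frechet\<close>): a locally bounded map that is
  holomorphic along complex lines after composition with a norming set of functionals is Frechet
  differentiable. Norming functionals, and the support functional on which the extremal map is built, come
  from the Hahn--Banach theorem, which is proved here through minimal sublinear functionals.

  In one variable, \<open>p = ((1 + w) / (1 - w)) powr \<beta>\<close> with a Schwarz function
  \<open>w = c\<^sub>1 t + c\<^sub>2 t\<^sup>2 + c\<^sub>3 t\<^sup>3 + \<dots>\<close>, and comparing coefficients expresses \<open>A\<^sub>2, A\<^sub>3, A\<^sub>4\<close> through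
  \<open>c\<^sub>1, c\<^sub>2, c\<^sub>3\<close>. The expression to be estimated is a Toeplitz determinant, and it factors as
  \<open>(A\<^sub>2 - A\<^sub>4) (A\<^sub>2\<^sup>2 - 2 A\<^sub>3\<^sup>2 + A\<^sub>2 A\<^sub>4)\<close>. Both factors have their largest modulus at \<open>c\<^sub>1 = \<i>\<close>,
  \<open>c\<^sub>2 = c\<^sub>3 = 0\<close>: the triangle inequality together with \<open>\<bar>c\<^sub>2\<bar>, \<bar>c\<^sub>3\<bar> \<le> 1 - \<bar>c\<^sub>1\<bar>\<^sup>2\<close> bounds each of them by a
  real polynomial in \<open>\<bar>c\<^sub>1\<bar>\<close> whose maximum over \<open>[0, 1]\<close> is attained at \<open>1\<close>. For \<open>w(t) = \<i> t\<close> only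
  powers of \<open>c\<^sub>1\<close> remain, and those in the same factor have the same argument, so that the triangle
  inequalities are equalities. The function of
  one variable belonging to this \<open>w\<close>, composed with a support functional, is extremal in any
  nonzero Banach space.
\<close>

section \<open>Support functionals in a complex normed space\<close>

definition sublinear :: "('a::real_vector \<Rightarrow> real) \<Rightarrow> bool" where
  "sublinear q \<longleftrightarrow> (\<forall>x y. q (x + y) \<le> q x + q y) \<and> (\<forall>x. \<forall>t\<ge>0. q (t *\<^sub>R x) = t * q x)"

lemma sublinear_lower_bound:
  assumes "sublinear q"
  shows "- q (- x) \<le> q x"
proof -
  have "q (0 *\<^sub>R x) = 0 * q x"
    using assms unfolding sublinear_def by blast
  moreover have "q (x + - x) \<le> q x + q (- x)"
    using assms unfolding sublinear_def by blast
  ultimately show ?thesis by simp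
qed

text \<open>For sublinear \<open>q\<close> this is the largest sublinear functional below \<open>q\<close> whose value at \<open>- y\<close> is at most \<open>- q y\<close>.
  It serves twice: it forces minimal sublinear functionals to be additive, and it
  prescribes the value of a dominated linear functional at one vector.\<close>

definition tilt :: "('a::real_vector \<Rightarrow> real) \<Rightarrow> 'a \<Rightarrow> 'a \<Rightarrow> real" where
  "tilt q y x = (INF t\<in>{0..}. q (x + t *\<^sub>R y) - t * q y)"

text \<open>Without this bound the infimum in the definition of \<^const>\<open>tilt\<close> would be an arbitrary real number.\<close>

lemma tilt_bdd:
  assumes q: "sublinear q"
  shows "bdd_below ((\<lambda>t. q (x + t *\<^sub>R y) - t * q y) ` {0..})"
proof (rule bdd_belowI2[where m = "- q (- x)"])
  fix t :: real assume t: "t \<in> {0..}"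
  have "q (t *\<^sub>R y) = q ((x + t *\<^sub>R y) + - x)" by simp
  also have "\<dots> \<le> q (x + t *\<^sub>R y) + q (- x)"
    using q unfolding sublinear_def by blast
  finally show "- q (- x) \<le> q (x + t *\<^sub>R y) - t * q y"
    using q t unfolding sublinear_def by auto
qed

lemma tilt_le:
  assumes "sublinear q" "0 \<le> t"
  shows "tilt q y x \<le> q (x + t *\<^sub>R y) - t * q y"
  unfolding tilt_def by (rule cINF_lower[OF tilt_bdd]) (use assms in auto)

lemma tilt_greatest:
  assumes "\<And>t. 0 \<le> t \<Longrightarrow> m \<le> q (x + t *\<^sub>R y) - t * q y"
  shows "m \<le> tilt q y x"
  unfolding tilt_def by (rule cINF_greatest) (use assms in auto)

lemma sublinear_tilt:
  assumes q: "sublinear q"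
  shows "sublinear (tilt q y)"
proof -
  have add: "q (u + v) \<le> q u + q v" for u v
    using q unfolding sublinear_def by blast
  have hom: "q (t *\<^sub>R u) = t * q u" if "0 \<le> t" for t u
    using q that unfolding sublinear_def by blast
  have "tilt q y (u + v) \<le> tilt q y u + tilt q y v" for u v
  proof -
    have "tilt q y (u + v) - (q (v + s *\<^sub>R y) - s * q y) \<le> q (u + t *\<^sub>R y) - t * q y"
      if "0 \<le> s" "0 \<le> t" for s t
      using tilt_le[OF q, of "s + t" y "u + v"] that add[of "u + t *\<^sub>R y" "v + s *\<^sub>R y"]
      by (simp add: algebra_simps)
    then have "tilt q y (u + v) - (q (v + s *\<^sub>R y) - s * q y) \<le> tilt q y u" if "0 \<le> s" for s
      using that by (intro tilt_greatest) auto
    then have "tilt q y (u + v) - tilt q y u \<le> tilt q y v"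
      by (intro tilt_greatest) (auto simp: algebra_simps)
    then show ?thesis by simp
  qed
  moreover have "tilt q y (c *\<^sub>R u) = c * tilt q y u" if "0 \<le> c" for c u
  proof (cases "c = 0")
    case True
    have "tilt q y 0 \<le> 0" using tilt_le[OF q, of 0 y 0] hom[of 0 0] by simp
    moreover have "0 \<le> tilt q y 0" by (rule tilt_greatest) (simp add: hom)
    ultimately show ?thesis using True by simp
  next
    case False
    with that have c: "0 < c" by simp
    have le: "tilt q y (a *\<^sub>R u) \<le> a * tilt q y u" if a: "0 < a" for a u
    proof -
      have "tilt q y (a *\<^sub>R u) / a \<le> tilt q y u"
      proof (rule tilt_greatest)
        fix t :: real assume t: "0 \<le> t"
        have "tilt q y (a *\<^sub>R u) \<le> q (a *\<^sub>R (u + t *\<^sub>R y)) - (a * t) * q y"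
          using tilt_le[OF q, of "a * t" y "a *\<^sub>R u"] a t by (simp add: algebra_simps)
        also have "\<dots> = a * (q (u + t *\<^sub>R y) - t * q y)"
          using hom[of a "u + t *\<^sub>R y"] a by (simp add: algebra_simps)
        finally show "tilt q y (a *\<^sub>R u) / a \<le> q (u + t *\<^sub>R y) - t * q y"
          using a by (simp add: field_simps)
      qed
      then show ?thesis using a by (simp add: field_simps)
    qed
    have "tilt q y ((1 / c) *\<^sub>R c *\<^sub>R u) \<le> (1 / c) * tilt q y (c *\<^sub>R u)"
      using c by (intro le) simp
    then have "c * tilt q y u \<le> tilt q y (c *\<^sub>R u)" using c by (simp add: field_simps)
    with le[OF c] show ?thesis by (simp add: antisym)
  qed
  ultimately show ?thesis unfolding sublinear_def by blast
qed

lemma tilt_le_self: "sublinear q \<Longrightarrow> tilt q y x \<le> q x"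
  using tilt_le[of q 0 y x] by simp

lemma chain_of_sublinear_lower_bound:
  assumes C: "\<And>q. q \<in> C \<Longrightarrow> sublinear q \<and> (\<forall>x. q x \<le> p x)"
    and chain: "\<And>q r. q \<in> C \<Longrightarrow> r \<in> C \<Longrightarrow> (\<forall>x. q x \<le> r x) \<or> (\<forall>x. r x \<le> q x)"
    and ne: "C \<noteq> {}"
  shows "\<exists>u. sublinear u \<and> (\<forall>q\<in>C. \<forall>x. u x \<le> q x)"
proof -
  define u where "u x = (INF q\<in>C. q x)" for x
  have bdd: "bdd_below ((\<lambda>q. q x) ` C)" for x
  proof (rule bdd_belowI2[where m = "- p (- x)"])
    fix q assume "q \<in> C"
    then show "- p (- x) \<le> q x"
      using sublinear_lower_bound[of q x] C[of q] by (meson dual_order.trans neg_le_iff_le)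
  qed
  have low: "u x \<le> q x" if "q \<in> C" for q x
    unfolding u_def by (rule cINF_lower[OF bdd that])
  have great: "m \<le> u x" if "\<And>q. q \<in> C \<Longrightarrow> m \<le> q x" for m x
    unfolding u_def by (rule cINF_greatest[OF ne that])
  have "u (x + y) \<le> u x + u y" for x y
  proof -
    have "u (x + y) - r y \<le> q x" if "q \<in> C" "r \<in> C" for q r
    proof -
      have "\<exists>s\<in>C. s x \<le> q x \<and> s y \<le> r y" using chain[OF that] that by blast
      then obtain s where s: "s \<in> C" "s x \<le> q x" "s y \<le> r y" by blast
      have "u (x + y) \<le> s (x + y)" by (rule low[OF s(1)])
      also have "\<dots> \<le> s x + s y" using C[OF s(1)] unfolding sublinear_def by blast
      finally show ?thesis using s by simp
    qed
    then have "u (x + y) - r y \<le> u x" if "r \<in> C" for r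
      using that by (intro great) auto
    then have "u (x + y) - u x \<le> u y"
      by (intro great) (auto simp: algebra_simps)
    then show ?thesis by simp
  qed
  moreover have "u (t *\<^sub>R x) = t * u x" if t: "0 \<le> t" for t x
  proof (cases "t = 0")
    case True
    have "q (0 *\<^sub>R x) = 0 * q x" if "q \<in> C" for q
      using C[OF that] unfolding sublinear_def by blast
    then show ?thesis using True ne low[of _ 0] great[of 0 0]
      by (metis (full_types) all_not_in_conv antisym mult_zero_left order_refl scaleR_zero_left)
  next
    case False
    with t have t: "0 < t" by simp
    have hom: "q (t *\<^sub>R x) = t * q x" if "q \<in> C" for q
      using C[OF that] t unfolding sublinear_def by (meson less_imp_le)
    have "t * u x \<le> u (t *\<^sub>R x)"
      using t by (intro great) (simp add: hom low)
    moreover have "u (t *\<^sub>R x) / t \<le> u x"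
      using t hom low[of _ "t *\<^sub>R x"] by (intro great) (simp add: field_simps)
    ultimately show ?thesis using t by (simp add: field_simps)
  qed
  ultimately show ?thesis using low unfolding sublinear_def by blast
qed

text \<open>Zorn's lemma for the reversed pointwise order.\<close>

lemma minimal_sublinear_below:
  assumes p: "sublinear p"
  shows "\<exists>h. sublinear h \<and> (\<forall>x. h x \<le> p x) \<and> (\<forall>q. sublinear q \<and> (\<forall>x. q x \<le> h x) \<longrightarrow> q = h)"
proof -
  define A where "A = {q. sublinear q \<and> (\<forall>x. q x \<le> p x)}"
  have "\<exists>m\<in>A. \<forall>a\<in>A. (\<forall>x. a x \<le> m x) \<longrightarrow> a = m"
  proof (rule predicate_Zorn[where P = "\<lambda>q r. \<forall>x. r x \<le> q x"])
    show "partial_order_on A (relation_of (\<lambda>q r. \<forall>x. r x \<le> q x) A)"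
      by (rule partial_order_on_relation_ofI) (auto intro: order_trans antisym simp: fun_eq_iff)
  next
    fix C assume C: "C \<in> Chains (relation_of (\<lambda>q r. \<forall>x. r x \<le> q x) A)"
    show "\<exists>u\<in>A. \<forall>a\<in>C. \<forall>x. u x \<le> a x"
    proof (cases "C = {}")
      case True then show ?thesis using p by (auto simp: A_def)
    next
      case False
      then obtain c where c: "c \<in> C" by blast
      have *: "q \<in> A" if "q \<in> C" for q
        using C that unfolding Chains_def relation_of_def by blast
      have "\<exists>u. sublinear u \<and> (\<forall>q\<in>C. \<forall>x. u x \<le> q x)"
      proof (rule chain_of_sublinear_lower_bound[of C p])
        show "sublinear q \<and> (\<forall>x. q x \<le> p x)" if "q \<in> C" for q
          using *[OF that] by (simp add: A_def)
        show "(\<forall>x. q x \<le> r x) \<or> (\<forall>x. r x \<le> q x)" if "q \<in> C" "r \<in> C" for q r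
          using C that unfolding Chains_def relation_of_def by blast
      qed fact
      then obtain u where u: "sublinear u" "\<And>q x. q \<in> C \<Longrightarrow> u x \<le> q x" by blast
      have "u \<in> A" using u c *[OF c] by (auto simp: A_def intro: order_trans)
      with u show ?thesis by blast
    qed
  qed
  then obtain h where h: "h \<in> A" "\<And>a. a \<in> A \<Longrightarrow> (\<forall>x. a x \<le> h x) \<Longrightarrow> a = h" by blast
  moreover have "q \<in> A" if "sublinear q" "\<forall>x. q x \<le> h x" for q
    using that h(1) by (auto simp: A_def intro: order_trans)
  ultimately show ?thesis by (auto simp: A_def)
qed

text \<open>A minimal sublinear functional \<open>h\<close> is linear. Tilting cannot make it smaller, so \<open>tilt h y = h\<close>; the choice
  \<open>t = 1\<close> in the infimum then gives \<open>h x + h y \<le> h (x + y)\<close>.\<close>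

lemma linear_below_sublinear:
  fixes p :: "'a::real_vector \<Rightarrow> real"
  assumes p: "sublinear p"
  shows "\<exists>h. linear h \<and> (\<forall>x. h x \<le> p x)"
proof -
  obtain h where h: "sublinear h" "\<And>x. h x \<le> p x"
    and min: "\<And>q. sublinear q \<Longrightarrow> (\<And>x. q x \<le> h x) \<Longrightarrow> q = h"
    using minimal_sublinear_below[OF p] by blast
  have add: "h (x + y) = h x + h y" for x y
  proof (rule antisym)
    show "h (x + y) \<le> h x + h y" using h(1) unfolding sublinear_def by blast
    have "tilt h y = h" by (intro min sublinear_tilt tilt_le_self h)
    then show "h x + h y \<le> h (x + y)" using tilt_le[OF h(1), of 1 y x] by simp
  qed
  have hom: "h (t *\<^sub>R x) = t * h x" if "0 \<le> t" for t x
    using h(1) that unfolding sublinear_def by blast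
  have neg: "h (- x) = - h x" for x
    using add[of x "- x"] hom[of 0 0] by simp
  have "h (t *\<^sub>R x) = t * h x" for t x
    using hom[of t x] hom[of "- t" x] neg[of "t *\<^sub>R x"] by (cases "0 \<le> t") auto
  then have "linear h" by (intro linearI) (simp_all add: add)
  with h(2) show ?thesis by blast
qed

text \<open>A real functional \<open>h\<close> dominated by \<open>tilt norm z\<close> satisfies \<open>h \<le> norm\<close> and \<open>h (- z) \<le> - norm z\<close>, hence
  \<open>h z = norm z\<close>. It is the real part of the complex functional \<open>x \<mapsto> h x - \<i> h (\<i> x)\<close>.\<close>

lemma support_functional_exists:
  fixes z :: "'a::complex_normed_vector"
  shows "\<exists>l. bounded_clinear l \<and> (\<forall>x. cmod (l x) \<le> norm x) \<and> l z = complex_of_real (norm z)"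
proof -
  have norm: "sublinear (norm :: 'a \<Rightarrow> real)"
    by (auto simp: sublinear_def norm_triangle_ineq)
  obtain h where h: "linear h" "\<And>x. h x \<le> tilt norm z x"
    using linear_below_sublinear[OF sublinear_tilt[OF norm]] by blast
  have h_le: "h x \<le> norm x" for x
    using h(2)[of x] tilt_le_self[OF norm, of z x] by linarith
  have "h (- z) \<le> - norm z"
    using h(2)[of "- z"] tilt_le[OF norm, of 1 z "- z"] by simp
  then have hz: "h z = norm z"
    using h_le[of z] linear_neg[OF h(1), of z] by simp
  define l where "l x = Complex (h x) (- h (\<i> *\<^sub>C x))" for x
  have ii: "\<i> *\<^sub>C \<i> *\<^sub>C x = - x" for x :: 'a
    using scaleC_scaleC[of \<i> \<i> x] scaleR_eq_scaleC[of "- 1" x] by simp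
  have rc: "\<i> *\<^sub>C (r *\<^sub>R x) = r *\<^sub>R (\<i> *\<^sub>C x)" for r and x :: 'a
    by (simp add: scaleR_eq_scaleC scaleC_scaleC mult.commute)
  have add: "l (x + y) = l x + l y" for x y
    by (simp add: l_def scaleC_add_right linear_add[OF h(1)] complex_eq_iff)
  have scR: "l (r *\<^sub>R x) = r *\<^sub>R l x" for r x
    by (simp add: l_def rc linear_cmul[OF h(1)] complex_eq_iff)
  have scI: "l (\<i> *\<^sub>C x) = \<i> * l x" for x
    by (simp add: l_def ii linear_neg[OF h(1)] complex_eq_iff)
  have scC: "l (c *\<^sub>C x) = c * l x" for c x
  proof -
    have "c *\<^sub>C x = (Re c) *\<^sub>R x + (Im c) *\<^sub>R (\<i> *\<^sub>C x)"
      by (simp add: scaleR_eq_scaleC scaleC_scaleC flip: scaleC_add_left)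
        (metis complex_eq mult.commute)
    then have "l (c *\<^sub>C x) = Re c * l x + Im c * (\<i> * l x)"
      by (simp add: add scR scI scaleR_conv_of_real)
    also have "\<dots> = c * l x" by (subst (3) complex_eq) (simp add: algebra_simps)
    finally show ?thesis .
  qed
  have bound: "cmod (l x) \<le> norm x" for x
  proof (cases "l x = 0")
    case False
    \<comment> \<open>Rotating \<open>x\<close> makes the value of \<open>l\<close> real, where it is controlled by \<open>h\<close>.\<close>
    define c where "c = cnj (sgn (l x))"
    have c: "cmod c = 1" using False by (simp add: c_def norm_sgn)
    have "l (c *\<^sub>C x) = cmod (l x)"
      using False complex_norm_square[of "l x"]
      by (simp add: scC c_def sgn_eq power2_eq_square field_simps)
    then have "cmod (l x) = Re (l (c *\<^sub>C x))" by simp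
    also have "\<dots> = h (c *\<^sub>C x)" by (simp add: l_def)
    also have "\<dots> \<le> norm (c *\<^sub>C x)" by (rule h_le)
    finally show ?thesis using c by (simp add: norm_scaleC)
  qed simp
  have "bounded_clinear l"
    unfolding bounded_clinear_def scaleC_complex_def
    by (auto intro!: bounded_linear_intro[where K = 1] simp: add scR scC bound)
  moreover have "l z = complex_of_real (norm z)"
  proof -
    have "Re (l z) = norm z" by (simp add: l_def hz)
    then have "(Re (l z))\<^sup>2 + (Im (l z))\<^sup>2 \<le> (Re (l z))\<^sup>2"
      using bound[of z] by (metis cmod_power2 norm_ge_zero power_mono)
    then show ?thesis using \<open>Re (l z) = norm z\<close> by (simp add: complex_eq_iff)
  qed
  ultimately show ?thesis using bound by blast
qed

lemma support_functionals_nonempty: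
  fixes z :: "'a::complex_normed_vector"
  assumes "z \<noteq> 0"
  shows "\<exists>l. l \<in> support_functionals z"
proof -
  obtain l where l: "bounded_clinear l" "\<And>x. cmod (l x) \<le> norm x" "l z = complex_of_real (norm z)"
    using support_functional_exists[of z] by blast
  have bl: "bounded_linear l" using l(1) by (simp add: bounded_clinear_def)
  have "onorm l \<le> 1" by (rule onorm_bound) (simp_all add: l)
  moreover have "1 \<le> onorm l"
    using le_onorm[OF bl, of z] l(3) assms by simp
  ultimately show ?thesis using l unfolding support_functionals_def by auto
qed

section \<open>Schwarz estimates on a disc\<close>

text \<open>The form in which remainder terms are discarded below: a quantity that is controlled up to a multiple of
  arbitrarily small \<open>s\<close> obeys the limiting inequality.\<close>

lemma le_if_le_add_small:
  fixes x A C d :: real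
  assumes d: "0 < d" and le: "\<And>s. 0 < s \<Longrightarrow> s < d \<Longrightarrow> x \<le> A + C * s"
  shows "x \<le> A"
proof (rule tendsto_lowerbound)
  have "((\<lambda>s. A + C * s) \<longlongrightarrow> A + C * 0) (at_right 0)"
    by (intro tendsto_intros)
  then show "((\<lambda>s. A + C * s) \<longlongrightarrow> A) (at_right 0)" by simp
  show "\<forall>\<^sub>F s in at_right 0. x \<le> A + C * s"
    unfolding eventually_at_right_field using le d by blast
qed simp

text \<open>The Schwarz lemma for \<open>(\<phi>(r z) - \<phi>(0)) / (2 (M + e))\<close>. The slack \<open>e\<close> makes the modulus
  strictly smaller than 1 and is removed at the end.\<close>

lemma Schwarz_difference_bound:
  assumes hol: "\<phi> holomorphic_on ball 0 r" and M: "\<And>z. cmod z < r \<Longrightarrow> cmod (\<phi> z) \<le> M"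
    and s: "cmod s < r"
  shows "cmod (\<phi> s - \<phi> 0) \<le> 2 * M / r * cmod s"
proof -
  have r: "0 < r" using s norm_ge_zero le_less_trans by blast
  have M0: "0 \<le> M" using order_trans[OF norm_ge_zero M[of 0]] r by simp
  have "cmod (\<phi> s - \<phi> 0) \<le> 2 * M / r * cmod s + (2 / r * cmod s) * e" if e: "0 < e" for e
  proof -
    define \<psi> where "\<psi> z = (\<phi> (of_real r * z) - \<phi> 0) / of_real (2 * (M + e))" for z
    have "cmod (\<psi> (s / of_real r)) \<le> cmod (s / of_real r)"
    proof (rule Schwarz_Lemma(1))
      have "(\<phi> \<circ> (\<lambda>z. of_real r * z)) holomorphic_on ball 0 1"
        using r by (intro holomorphic_on_compose holomorphic_intros holomorphic_on_subset[OF hol])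
          (auto simp: norm_mult)
      then show "\<psi> holomorphic_on ball 0 1"
        unfolding \<psi>_def o_def using M0 e by (intro holomorphic_intros) (auto simp flip: of_real_add)
      show "\<psi> 0 = 0" by (simp add: \<psi>_def)
      show "cmod (s / of_real r) < 1" using s r by (simp add: norm_divide)
      fix z :: complex assume z: "cmod z < 1"
      have "cmod (of_real r * z) < r" using z r by (simp add: norm_mult)
      then have "cmod (\<phi> (of_real r * z) - \<phi> 0) \<le> M + M"
        using norm_triangle_ineq4[of "\<phi> (of_real r * z)" "\<phi> 0"] M[of 0] M[of "of_real r * z"] r by simp
      then show "cmod (\<psi> z) < 1" using e M0 unfolding \<psi>_def norm_divide norm_of_real by simp
    qed
    then show ?thesis using r e M0 unfolding \<psi>_def norm_divide norm_of_real
      by (simp add: field_simps)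
  qed
  then show ?thesis by (rule le_if_le_add_small[OF zero_less_one])
qed

text \<open>The difference quotient \<open>d\<close> of \<open>\<phi>\<close> at \<open>0\<close> is itself bounded and holomorphic, so the
  difference bound applies to it once more. This replaces the Cauchy estimates for the first two Taylor
  coefficients.\<close>

lemma Schwarz_slope:
  assumes hol: "\<phi> holomorphic_on ball 0 r" and M: "\<And>z. cmod z < r \<Longrightarrow> cmod (\<phi> z) \<le> M"
    and r: "0 < r"
  obtains d where "d holomorphic_on ball 0 r" and "\<And>z. cmod z < r \<Longrightarrow> \<phi> z = \<phi> 0 + z * d z"
    and "deriv \<phi> 0 = d 0" and "\<And>z. cmod z < r \<Longrightarrow> cmod (d z) \<le> 2 * M / r"
    and "\<And>z. cmod z < r \<Longrightarrow> cmod (d z - d 0) \<le> 4 * M / r\<^sup>2 * cmod z"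
proof -
  have "(\<lambda>z. \<phi> z - \<phi> 0) holomorphic_on ball 0 r" by (intro holomorphic_intros hol)
  then obtain d where d: "d holomorphic_on ball 0 r" "\<And>z. cmod z < r \<Longrightarrow> \<phi> z - \<phi> 0 = z * d z"
    and d0: "deriv (\<lambda>z. \<phi> z - \<phi> 0) 0 = d 0"
    using Schwarz3[of "\<lambda>z. \<phi> z - \<phi> 0" r] by auto
  have "\<phi> field_differentiable at 0"
    using hol r by (auto intro: holomorphic_on_imp_differentiable_at)
  then have d0': "deriv \<phi> 0 = d 0" using d0 by simp
  have bd: "cmod (d z) \<le> 2 * M / r" if z: "cmod z < r" "z \<noteq> 0" for z
  proof -
    have "cmod z * cmod (d z) \<le> cmod z * (2 * M / r)"
      using Schwarz_difference_bound[OF hol M z(1)] d(2)[OF z(1)]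
      by (simp add: norm_mult mult.commute)
    then show ?thesis by (rule mult_left_le_imp_le) (use z(2) in simp)
  qed
  have "isCont d 0"
    using d(1) r by (metis centre_in_ball continuous_on_eq_continuous_at holomorphic_on_imp_continuous_on open_ball)
  then have "((\<lambda>z. cmod (d z)) \<longlongrightarrow> cmod (d 0)) (at 0)"
    by (intro tendsto_norm) (simp add: isCont_def)
  moreover have "\<forall>\<^sub>F z in at 0. cmod (d z) \<le> 2 * M / r"
    unfolding eventually_at using r bd by (auto intro!: exI[of _ r])
  ultimately have bd0: "cmod (d 0) \<le> 2 * M / r"
    by (rule tendsto_upperbound) simp
  have bd: "cmod (d z) \<le> 2 * M / r" if "cmod z < r" for z
    using bd[OF that] bd0 by (cases "z = 0") auto
  have dd: "cmod (d z - d 0) \<le> 4 * M / r\<^sup>2 * cmod z" if "cmod z < r" for z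
    using Schwarz_difference_bound[OF d(1) bd that] by (simp add: power2_eq_square)
  have eq: "\<phi> z = \<phi> 0 + z * d z" if "cmod z < r" for z
    using d(2)[OF that] by (simp add: diff_eq_eq add.commute)
  show ?thesis by (rule that[OF d(1) eq d0' bd dd])
qed

section \<open>Holomorphic maps between complex Banach spaces\<close>

lemma bounded_linear_scaleC: "bounded_linear (\<lambda>x::'a::complex_normed_vector. c *\<^sub>C x)"
  by (rule bounded_linear_intro[where K = "cmod c"])
    (simp_all add: scaleC_add_right scaleR_eq_scaleC scaleC_scaleC norm_scaleC mult.commute)

text \<open>Frechet derivatives take values in the type of real-linear bounded operators. Scalar multiplication in
  the target makes that type a complex Banach space, so that \<^const>\<open>fderiv\<close> can be iterated within the
  same theory.\<close>

instantiation blinfun :: (real_normed_vector, complex_normed_vector) complex_normed_vector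
begin

lift_definition scaleC_blinfun :: "complex \<Rightarrow> 'a \<Rightarrow>\<^sub>L 'b \<Rightarrow> 'a \<Rightarrow>\<^sub>L 'b" is "\<lambda>c f x. c *\<^sub>C f x"
  by (rule bounded_linear_compose[OF bounded_linear_scaleC])

instance
proof
  fix a b :: complex and f g :: "'a \<Rightarrow>\<^sub>L 'b" and r :: real
  show "a *\<^sub>C (f + g) = a *\<^sub>C f + a *\<^sub>C g"
    by transfer (simp add: scaleC_add_right)
  show "(a + b) *\<^sub>C f = a *\<^sub>C f + b *\<^sub>C f"
    by transfer (simp add: scaleC_add_left)
  show "a *\<^sub>C b *\<^sub>C f = (a * b) *\<^sub>C f"
    by transfer (simp add: scaleC_scaleC)
  show one: "1 *\<^sub>C f = f"
    by transfer (simp add: scaleC_one)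
  show "r *\<^sub>R f = complex_of_real r *\<^sub>C f"
    by transfer (simp add: scaleR_eq_scaleC)
  have le: "norm (c *\<^sub>C h) \<le> cmod c * norm h" for c and h :: "'a \<Rightarrow>\<^sub>L 'b"
  proof (rule norm_blinfun_bound)
    fix x
    have "norm (blinfun_apply (c *\<^sub>C h) x) = cmod c * norm (h x)"
      by transfer (simp add: norm_scaleC)
    also have "\<dots> \<le> cmod c * (norm h * norm x)"
      by (intro mult_left_mono norm_blinfun) simp
    finally show "norm (blinfun_apply (c *\<^sub>C h) x) \<le> cmod c * norm h * norm x"
      by (simp add: mult.assoc)
  qed simp
  show "norm (a *\<^sub>C f) = cmod a * norm f"
  proof (cases "a = 0")
    case True
    then show ?thesis using le[of a f] by simp
  next
    case False
    have "f = inverse a *\<^sub>C a *\<^sub>C f"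
      using False one by transfer (simp add: scaleC_scaleC)
    then have "norm f \<le> norm (a *\<^sub>C f) / cmod a"
      using le[of "inverse a" "a *\<^sub>C f"] by (simp add: norm_inverse divide_inverse mult.commute)
    then have "cmod a * norm f \<le> norm (a *\<^sub>C f)"
      using False by (simp add: field_simps)
    with le[of a f] show ?thesis by simp
  qed
qed

end

instance blinfun :: (real_normed_vector, complex_banach) complex_banach ..

text \<open>The second clause also excludes the empty set, for which it would bound every norm by a negative \<open>c\<close>.\<close>

definition norming :: "('b::complex_normed_vector \<Rightarrow> complex) set \<Rightarrow> bool" where
  "norming \<Lambda> \<longleftrightarrow> (\<forall>l\<in>\<Lambda>. bounded_clinear l \<and> (\<forall>y. cmod (l y) \<le> norm y)) \<and>
     (\<forall>y c. (\<forall>l\<in>\<Lambda>. cmod (l y) \<le> c) \<longrightarrow> norm y \<le> c)"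

lemma scaleC_zero_left: "0 *\<^sub>C (x::'a::complex_vector) = 0"
  using scaleR_eq_scaleC[of 0 x] by simp

lemma scaleC_zero_right: "c *\<^sub>C (0::'a::complex_vector) = 0"
  using scaleC_add_right[of c "0::'a" 0] by simp

lemma scaleC_diff_right: "c *\<^sub>C (x - y) = c *\<^sub>C x - c *\<^sub>C (y::'a::complex_vector)"
  using scaleC_add_right[of c "x - y" y] by (simp add: algebra_simps)

lemma bounded_clinearD:
  assumes "bounded_clinear l"
  shows "l (x + y) = l x + l y" "l (x - y) = l x - l y" "l (c *\<^sub>C x) = c *\<^sub>C l x" "l 0 = 0"
  using assms unfolding bounded_clinear_def
  by (auto simp: linear_simps bounded_linear.linear linear_diff linear_add linear_0)

text \<open>The norm of a vector is controlled by its images under \<open>\<Lambda>\<close>, so the one-variable estimates become norm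
  estimates that are uniform over all complex lines through a point: \<open>g\<close> is Lipschitz near \<open>z\<^sub>0\<close>, its second
  differences are of order \<open>norm h * norm k\<close>, and its difference quotients in a direction \<open>h\<close> form a Cauchy
  family with a linear rate. Completeness yields the directional derivatives \<open>B h\<close> with an error that is
  quadratic in the increment. Homogeneity of \<open>B\<close> is clear, and the bound on second differences makes \<open>B\<close>
  additive.\<close>

theorem weakly_holomorphic_imp_frechet:
  fixes g :: "'a::complex_normed_vector \<Rightarrow> 'b::complex_banach"
  assumes R: "0 < R" and M: "\<And>z. z \<in> ball z\<^sub>0 (2 * R) \<Longrightarrow> norm (g z) \<le> M"
    and \<Lambda>: "norming \<Lambda>"
    and weak: "\<And>l z h. l \<in> \<Lambda> \<Longrightarrow>
      (\<lambda>s. l (g (z + s *\<^sub>C h))) holomorphic_on {s. z + s *\<^sub>C h \<in> ball z\<^sub>0 (2 * R)}"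
  shows "\<exists>D. bounded_clinear D \<and> (g has_derivative D) (at z\<^sub>0)"
proof -
  have lin: "bounded_clinear l" and le_norm: "cmod (l y) \<le> norm y" if "l \<in> \<Lambda>" for l y
    using \<Lambda> that unfolding norming_def by auto
  have normI: "norm y \<le> c" if "\<And>l. l \<in> \<Lambda> \<Longrightarrow> cmod (l y) \<le> c" for y c
    using \<Lambda> that unfolding norming_def by blast
  have M0: "0 \<le> M" using M[of z\<^sub>0] R by (meson centre_in_ball mult_pos_pos norm_ge_zero order_trans zero_less_numeral)
  have inb: "z + s *\<^sub>C h \<in> ball z\<^sub>0 (2 * R)" if "z \<in> ball z\<^sub>0 R" "cmod s < R / norm h" "h \<noteq> 0" for z h s
  proof -
    have "norm (s *\<^sub>C h) < R" using that by (simp add: norm_scaleC field_simps)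
    then show ?thesis using that(1) norm_triangle_ineq4[of "z\<^sub>0 - z" "s *\<^sub>C h"]
      by (simp add: dist_norm diff_diff_eq)
  qed
  have line: "(\<lambda>s. l (g (z + s *\<^sub>C h))) holomorphic_on ball 0 (R / norm h)"
    if "l \<in> \<Lambda>" "z \<in> ball z\<^sub>0 R" "h \<noteq> 0" for l z h
    by (rule holomorphic_on_subset[OF weak[OF that(1)]]) (use that inb in auto)
  have line_le: "cmod (l (g (z + s *\<^sub>C h))) \<le> M"
    if "l \<in> \<Lambda>" "z \<in> ball z\<^sub>0 R" "h \<noteq> 0" "cmod s < R / norm h" for l z h s
    using le_norm[OF that(1)] M[OF inb[OF that(2,4,3)]] order_trans by blast
  have z0: "z\<^sub>0 \<in> ball z\<^sub>0 R" using R by simp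
  have lip: "norm (g (z + h) - g z) \<le> 2 * M / R * norm h" if z: "z \<in> ball z\<^sub>0 R" and h: "norm h < R" for z h
  proof (cases "h = 0")
    case False
    have 1: "cmod 1 < R / norm h" using False h by simp
    show ?thesis
    proof (rule normI)
      fix l assume l: "l \<in> \<Lambda>"
      show "cmod (l (g (z + h) - g z)) \<le> 2 * M / R * norm h"
        using Schwarz_difference_bound[OF line[OF l z False] line_le[OF l z False] 1]
        by (simp add: bounded_clinearD(2)[OF lin[OF l]] scaleC_one scaleC_zero_left)
    qed
  qed simp
  \<comment> \<open>The increment of \<open>g\<close> by \<open>k\<close> is of size \<open>norm k\<close> and holomorphic in the base point; the difference bound
     in the direction \<open>h\<close> contributes the factor \<open>norm h\<close>.\<close>
  have diff2: "norm (g (z\<^sub>0 + h + k) - g (z\<^sub>0 + h) - (g (z\<^sub>0 + k) - g z\<^sub>0)) \<le> 4 * M / R\<^sup>2 * norm h * norm k"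
    if h: "norm h < R" and k: "norm k < R" for h k
  proof (cases "h = 0")
    case False
    have 1: "cmod 1 < R / norm h" using False h by simp
    show ?thesis
    proof (rule normI)
      fix l assume l: "l \<in> \<Lambda>"
      have in0: "z\<^sub>0 + s *\<^sub>C h \<in> ball z\<^sub>0 R" if "cmod s < R / norm h" for s
        using that False by (simp add: dist_norm norm_scaleC field_simps)
      have in2: "z\<^sub>0 + k + s *\<^sub>C h \<in> ball z\<^sub>0 (2 * R)" if "cmod s < R / norm h" for s
        using inb[OF _ that False, of "z\<^sub>0 + k"] k by (simp add: dist_norm)
      have "(\<lambda>s. l (g (z\<^sub>0 + k + s *\<^sub>C h)) - l (g (z\<^sub>0 + s *\<^sub>C h))) holomorphic_on ball 0 (R / norm h)"
        by (intro holomorphic_on_diff line[OF l z0 False] holomorphic_on_subset[OF weak[OF l]])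
          (use in2 in auto)
      moreover have "cmod (l (g (z\<^sub>0 + k + s *\<^sub>C h)) - l (g (z\<^sub>0 + s *\<^sub>C h))) \<le> 2 * M / R * norm k"
        if s: "cmod s < R / norm h" for s
      proof -
        have "cmod (l (g (z\<^sub>0 + s *\<^sub>C h + k) - g (z\<^sub>0 + s *\<^sub>C h))) \<le> 2 * M / R * norm k"
          by (rule order_trans[OF le_norm[OF l] lip[OF in0[OF s] k]])
        then show ?thesis
          by (simp only: bounded_clinearD(2)[OF lin[OF l]] add.assoc add.commute[of k])
      qed
      ultimately have "cmod ((l (g (z\<^sub>0 + k + h)) - l (g (z\<^sub>0 + h))) - (l (g (z\<^sub>0 + k)) - l (g z\<^sub>0)))
          \<le> 2 * (2 * M / R * norm k) / (R / norm h) * cmod 1"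
        using Schwarz_difference_bound[of "\<lambda>s. l (g (z\<^sub>0 + k + s *\<^sub>C h)) - l (g (z\<^sub>0 + s *\<^sub>C h))" "R / norm h"
          "2 * M / R * norm k" 1] 1
        by (simp add: scaleC_one scaleC_zero_left)
      then show "cmod (l (g (z\<^sub>0 + h + k) - g (z\<^sub>0 + h) - (g (z\<^sub>0 + k) - g z\<^sub>0))) \<le> 4 * M / R\<^sup>2 * norm h * norm k"
        by (simp add: bounded_clinearD(2)[OF lin[OF l]] add_ac power2_eq_square mult_ac)
    qed
  qed simp
  define C where "C = 4 * M / R\<^sup>2"
  have C0: "0 \<le> C" using M0 by (simp add: C_def)
  define Q where "Q h s = inverse s *\<^sub>C (g (z\<^sub>0 + s *\<^sub>C h) - g z\<^sub>0)" for h and s :: complex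
  have quot: "norm (Q h s - Q h t) \<le> C * (norm h)\<^sup>2 * (cmod s + cmod t)"
    if s: "s \<noteq> 0" "cmod s * norm h < R" and t: "t \<noteq> 0" "cmod t * norm h < R" for h s t
  proof (cases "h = 0")
    case True
    then show ?thesis by (simp add: Q_def scaleC_zero_right)
  next
    case False
    show ?thesis
    proof (rule normI)
      fix l assume l: "l \<in> \<Lambda>"
      have r: "0 < R / norm h" using False R by simp
      have s': "cmod s < R / norm h" and t': "cmod t < R / norm h"
        using s t False by (simp_all add: field_simps)
      obtain d where d: "\<And>z. cmod z < R / norm h \<Longrightarrow> l (g (z\<^sub>0 + z *\<^sub>C h)) = l (g (z\<^sub>0 + 0 *\<^sub>C h)) + z * d z"
        "\<And>z. cmod z < R / norm h \<Longrightarrow> cmod (d z - d 0) \<le> 4 * M / (R / norm h)\<^sup>2 * cmod z"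
        using Schwarz_slope[OF line[OF l z0 False] line_le[OF l z0 False] r] by metis
      have Qd: "l (Q h u) = d u" if "u \<noteq> 0" "cmod u < R / norm h" for u
        using d(1)[OF that(2)] that(1)
        by (simp add: Q_def bounded_clinearD[OF lin[OF l]] scaleC_zero_left scaleC_complex_def)
      have "cmod (d s - d t) \<le> cmod (d s - d 0) + cmod (d t - d 0)"
        using norm_triangle_ineq4[of "d s - d 0" "d t - d 0"] by simp
      also have "\<dots> \<le> C * (norm h)\<^sup>2 * (cmod s + cmod t)"
        using d(2)[OF s'] d(2)[OF t'] by (simp add: C_def power_divide distrib_left)
      finally show "cmod (l (Q h s - Q h t)) \<le> C * (norm h)\<^sup>2 * (cmod s + cmod t)"
        by (simp add: bounded_clinearD(2)[OF lin[OF l]] Qd s s' t t')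
    qed
  qed
  have "\<exists>b. \<forall>s. cmod s * norm h < R \<longrightarrow>
      norm (g (z\<^sub>0 + s *\<^sub>C h) - g z\<^sub>0 - s *\<^sub>C b) \<le> C * (cmod s)\<^sup>2 * (norm h)\<^sup>2" for h
  proof -
    \<comment> \<open>\<open>N\<close> makes the whole sequence of increments \<open>t n *\<^sub>C h\<close> shorter than \<open>R\<close>.\<close>
    obtain N :: nat where N: "norm h < R * real (Suc N)"
      using reals_Archimedean2[of "norm h / R"] R
      by (metis less_SucI mult.commute of_nat_less_iff order_less_trans pos_divide_less_eq lessI)
    define t :: "nat \<Rightarrow> complex" where "t n = of_real (1 / real (Suc (N + n)))" for n
    have t0: "t n \<noteq> 0" for n by (simp add: t_def del: of_nat_Suc)
    have tm: "cmod (t n) = 1 / real (Suc (N + n))" for n unfolding t_def norm_of_real by simp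
    have tR: "cmod (t n) * norm h < R" for n
    proof -
      have "norm h < R * real (Suc (N + n))"
        using N R by (smt (verit) Suc_le_mono le_add1 mult_left_mono of_nat_le_iff)
      then show ?thesis unfolding tm by (simp add: field_simps)
    qed
    have tlim: "(\<lambda>n. cmod (t n)) \<longlonglongrightarrow> 0"
      unfolding tm using LIMSEQ_ignore_initial_segment[OF LIMSEQ_inverse_real_of_nat, of N]
      by (simp add: inverse_eq_divide add.commute)
    define X where "X n = Q h (t n)" for n
    have "Cauchy X"
    proof (rule metric_CauchyI)
      fix e :: real assume e: "0 < e"
      have "(\<lambda>n. C * (norm h)\<^sup>2 * cmod (t n)) \<longlonglongrightarrow> C * (norm h)\<^sup>2 * 0"
        by (intro tendsto_intros tlim)
      then have "\<forall>\<^sub>F n in sequentially. C * (norm h)\<^sup>2 * cmod (t n) < e / 2"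
        using e by (intro order_tendstoD) auto
      then obtain n0 where n0: "\<And>n. n0 \<le> n \<Longrightarrow> C * (norm h)\<^sup>2 * cmod (t n) < e / 2"
        unfolding eventually_sequentially by blast
      have "dist (X m) (X n) < e" if "n0 \<le> m" "n0 \<le> n" for m n
        using quot[OF t0 tR t0 tR, of m n] n0[OF that(1)] n0[OF that(2)]
        by (simp add: X_def dist_norm distrib_left)
      then show "\<exists>n0. \<forall>m\<ge>n0. \<forall>n\<ge>n0. dist (X m) (X n) < e" by blast
    qed
    then obtain b where b: "X \<longlonglongrightarrow> b"
      using Cauchy_convergent convergent_def by blast
    have "norm (g (z\<^sub>0 + s *\<^sub>C h) - g z\<^sub>0 - s *\<^sub>C b) \<le> C * (cmod s)\<^sup>2 * (norm h)\<^sup>2"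
      if s: "cmod s * norm h < R" for s
    proof (cases "s = 0")
      case False
      have "norm (Q h s - b) \<le> C * (norm h)\<^sup>2 * (cmod s + 0)"
      proof (rule LIMSEQ_le)
        show "(\<lambda>n. norm (Q h s - X n)) \<longlonglongrightarrow> norm (Q h s - b)"
          by (intro tendsto_intros b)
        show "(\<lambda>n. C * (norm h)\<^sup>2 * (cmod s + cmod (t n))) \<longlonglongrightarrow> C * (norm h)\<^sup>2 * (cmod s + 0)"
          by (intro tendsto_intros tlim)
        show "\<exists>N. \<forall>n\<ge>N. norm (Q h s - X n) \<le> C * (norm h)\<^sup>2 * (cmod s + cmod (t n))"
          unfolding X_def using quot[OF False s t0 tR] by blast
      qed
      then have "cmod s * norm (Q h s - b) \<le> cmod s * (C * (norm h)\<^sup>2 * cmod s)"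
        by (intro mult_left_mono) auto
      moreover have "g (z\<^sub>0 + s *\<^sub>C h) - g z\<^sub>0 - s *\<^sub>C b = s *\<^sub>C (Q h s - b)"
        using False by (simp add: Q_def scaleC_diff_right scaleC_scaleC scaleC_one)
      ultimately show ?thesis by (simp add: norm_scaleC power2_eq_square mult_ac)
    qed (simp add: scaleC_zero_left)
    then show ?thesis by blast
  qed
  then obtain B where B: "\<And>h s. cmod s * norm h < R \<Longrightarrow>
      norm (g (z\<^sub>0 + s *\<^sub>C h) - g z\<^sub>0 - s *\<^sub>C B h) \<le> C * (cmod s)\<^sup>2 * (norm h)\<^sup>2"
    by metis
  have Breal: "norm (g (z\<^sub>0 + s *\<^sub>R h) - g z\<^sub>0 - s *\<^sub>R B h) \<le> C * s\<^sup>2 * (norm h)\<^sup>2"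
    if "0 \<le> s" "s * norm h < R" for s h
    using B[of "of_real s" h] that by (simp add: scaleR_eq_scaleC)
  have small: "\<exists>d>0. \<forall>s. 0 < s \<and> s < d \<longrightarrow> s * a < R" for a
    by (rule exI[of _ "R / (\<bar>a\<bar> + 1)"]) 
       (use R in \<open>auto simp: field_simps intro: le_less_trans[OF mult_left_mono[of a "\<bar>a\<bar>"]]\<close>)
  have zeroI: "v = 0" if d: "0 < d" and le: "\<And>s. 0 < s \<Longrightarrow> s < d \<Longrightarrow> norm (s *\<^sub>R v) \<le> K * s\<^sup>2"
    for v :: 'b and d K
  proof -
    have "norm v \<le> 0"
    proof (rule le_if_le_add_small[OF d, where C = K])
      fix s :: real assume s: "0 < s" "s < d"
      show "norm v \<le> 0 + K * s" using le[OF s] s by (simp add: power2_eq_square)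
    qed
    then show ?thesis by simp
  qed
  have hom: "B (c *\<^sub>C h) = c *\<^sub>C B h" for c h
  proof -
    obtain d1 where d1: "0 < d1" "\<And>s. 0 < s \<Longrightarrow> s < d1 \<Longrightarrow> s * norm (c *\<^sub>C h) < R"
      using small by blast
    have "B (c *\<^sub>C h) - c *\<^sub>C B h = 0"
    proof (rule zeroI[OF d1(1)])
      fix s :: real assume s: "0 < s" "s < d1"
      have 1: "norm (g (z\<^sub>0 + s *\<^sub>R c *\<^sub>C h) - g z\<^sub>0 - s *\<^sub>R B (c *\<^sub>C h)) \<le> C * s\<^sup>2 * (norm (c *\<^sub>C h))\<^sup>2"
        using Breal[of s "c *\<^sub>C h"] s d1(2)[OF s] by simp
      have 2: "norm (g (z\<^sub>0 + s *\<^sub>R c *\<^sub>C h) - g z\<^sub>0 - s *\<^sub>R c *\<^sub>C B h) \<le> C * s\<^sup>2 * (norm (c *\<^sub>C h))\<^sup>2"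
        using B[of "of_real s * c" h] s d1(2)[OF s]
        by (simp add: scaleR_eq_scaleC scaleC_scaleC norm_mult norm_scaleC power_mult_distrib mult_ac)
      show "norm (s *\<^sub>R (B (c *\<^sub>C h) - c *\<^sub>C B h)) \<le> (2 * C * (norm (c *\<^sub>C h))\<^sup>2) * s\<^sup>2"
        using norm_triangle_ineq4[of "g (z\<^sub>0 + s *\<^sub>R c *\<^sub>C h) - g z\<^sub>0 - s *\<^sub>R c *\<^sub>C B h"
            "g (z\<^sub>0 + s *\<^sub>R c *\<^sub>C h) - g z\<^sub>0 - s *\<^sub>R B (c *\<^sub>C h)"] 1 2
        by (simp add: scaleR_diff_right algebra_simps)
    qed
    then show ?thesis by simp
  qed
  have tri: "norm (a + b + c - d) \<le> norm a + norm b + norm c + norm d" for a b c d :: 'b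
    using norm_triangle_ineq4[of "a + b + c" d] norm_triangle_ineq[of "a + b" c]
      norm_triangle_ineq[of a b] by linarith
  \<comment> \<open>The second difference along \<open>s h\<close> and \<open>s k\<close>, together with the three remainders, is of order \<open>s\<^sup>2\<close>.\<close>
  have add: "B (h + k) = B h + B k" for h k
  proof -
    obtain d1 where d1: "0 < d1" "\<And>s. 0 < s \<Longrightarrow> s < d1 \<Longrightarrow> s * (norm h + norm k) < R"
      using small by blast
    have "B (h + k) - B h - B k = 0"
    proof (rule zeroI[OF d1(1)])
      fix s :: real assume s: "0 < s" "s < d1"
      have h: "s * norm h < R" and k: "s * norm k < R"
        using d1(2)[OF s] s by (smt (verit) distrib_left mult_nonneg_nonneg norm_ge_zero)+
      have hk: "s * norm (h + k) < R"
        using d1(2)[OF s] s norm_triangle_ineq[of h k] by (smt (verit) mult_left_mono)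
      have 0: "norm (g (z\<^sub>0 + s *\<^sub>R h + s *\<^sub>R k) - g (z\<^sub>0 + s *\<^sub>R h) - (g (z\<^sub>0 + s *\<^sub>R k) - g z\<^sub>0))
          \<le> C * norm (s *\<^sub>R h) * norm (s *\<^sub>R k)"
        unfolding C_def by (rule diff2) (use h k s in auto)
      note 1 = Breal[OF less_imp_le[OF s(1)] h] and 2 = Breal[OF less_imp_le[OF s(1)] k]
        and 3 = Breal[OF less_imp_le[OF s(1)] hk]
      have "s *\<^sub>R (B (h + k) - B h - B k) =
          (g (z\<^sub>0 + s *\<^sub>R h + s *\<^sub>R k) - g (z\<^sub>0 + s *\<^sub>R h) - (g (z\<^sub>0 + s *\<^sub>R k) - g z\<^sub>0))
          + (g (z\<^sub>0 + s *\<^sub>R h) - g z\<^sub>0 - s *\<^sub>R B h) + (g (z\<^sub>0 + s *\<^sub>R k) - g z\<^sub>0 - s *\<^sub>R B k)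
          - (g (z\<^sub>0 + s *\<^sub>R (h + k)) - g z\<^sub>0 - s *\<^sub>R B (h + k))" (is "_ = ?a + ?b + ?c - ?d")
        by (simp add: algebra_simps)
      then have "norm (s *\<^sub>R (B (h + k) - B h - B k)) \<le> norm ?a + norm ?b + norm ?c + norm ?d"
        by (simp only: tri)
      also have "\<dots> \<le> C * norm (s *\<^sub>R h) * norm (s *\<^sub>R k) + C * s\<^sup>2 * (norm h)\<^sup>2
          + C * s\<^sup>2 * (norm k)\<^sup>2 + C * s\<^sup>2 * (norm (h + k))\<^sup>2"
        using 0 1 2 3 by linarith
      also have "\<dots> = (C * (norm h * norm k + (norm h)\<^sup>2 + (norm k)\<^sup>2 + (norm (h + k))\<^sup>2)) * s\<^sup>2"
        using s by (simp add: power2_eq_square algebra_simps)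
      finally show "norm (s *\<^sub>R (B (h + k) - B h - B k))
          \<le> (C * (norm h * norm k + (norm h)\<^sup>2 + (norm k)\<^sup>2 + (norm (h + k))\<^sup>2)) * s\<^sup>2" .
    qed
    then show ?thesis by (simp add: algebra_simps)
  qed
  have bound: "norm (B h) \<le> norm h * (2 * M / R)" for h
  proof -
    obtain d1 where d1: "0 < d1" "\<And>s. 0 < s \<Longrightarrow> s < d1 \<Longrightarrow> s * norm h < R"
      using small by blast
    show ?thesis
    proof (rule le_if_le_add_small[OF d1(1), where C = "C * (norm h)\<^sup>2"])
      fix s :: real assume s: "0 < s" "s < d1"
      have "norm (s *\<^sub>R B h) \<le> norm (g (z\<^sub>0 + s *\<^sub>R h) - g z\<^sub>0) + norm (g (z\<^sub>0 + s *\<^sub>R h) - g z\<^sub>0 - s *\<^sub>R B h)"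
        using norm_triangle_ineq4[of "g (z\<^sub>0 + s *\<^sub>R h) - g z\<^sub>0" "g (z\<^sub>0 + s *\<^sub>R h) - g z\<^sub>0 - s *\<^sub>R B h"]
        by simp
      also have "\<dots> \<le> 2 * M / R * norm (s *\<^sub>R h) + C * s\<^sup>2 * (norm h)\<^sup>2"
        using lip[OF z0, of "s *\<^sub>R h"] Breal[of s h] s d1(2)[OF s] by simp
      also have "\<dots> = s * (norm h * (2 * M / R) + C * (norm h)\<^sup>2 * s)"
        using s by (simp add: power2_eq_square algebra_simps)
      finally show "norm (B h) \<le> norm h * (2 * M / R) + C * (norm h)\<^sup>2 * s"
        using s by simp
    qed
  qed
  have BB: "bounded_linear B"
    by (rule bounded_linear_intro[OF add _ bound]) (simp add: scaleR_eq_scaleC hom)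
  have "(g has_derivative B) (at z\<^sub>0)"
  proof (rule has_derivativeI_sandwich[OF R BB])
    fix y assume y: "y \<in> UNIV" "y \<noteq> z\<^sub>0" "dist y z\<^sub>0 < R"
    have "norm (g y - g z\<^sub>0 - B (y - z\<^sub>0)) \<le> C * (norm (y - z\<^sub>0))\<^sup>2"
      using Breal[of 1 "y - z\<^sub>0"] y by (simp add: dist_norm)
    then show "norm (g y - g z\<^sub>0 - B (y - z\<^sub>0)) / norm (y - z\<^sub>0) \<le> C * norm (y - z\<^sub>0)"
      using y by (simp add: field_simps power2_eq_square)
  next
    show "((\<lambda>y. C * norm (y - z\<^sub>0)) \<longlongrightarrow> 0) (at z\<^sub>0)"
      by (auto intro!: tendsto_eq_intros)
  qed
  then show ?thesis using BB hom unfolding bounded_clinear_def by blast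
qed

definition contractive_functionals :: "('b::complex_normed_vector \<Rightarrow> complex) set" where
  "contractive_functionals = {l. bounded_clinear l \<and> (\<forall>y. cmod (l y) \<le> norm y)}"

lemma norming_contractive_functionals:
  "norming (contractive_functionals :: ('b::complex_normed_vector \<Rightarrow> complex) set)"
proof -
  have "norm y \<le> c" if le: "\<And>l. l \<in> contractive_functionals \<Longrightarrow> cmod (l y) \<le> c" for y :: 'b and c
  proof -
    obtain l where "l \<in> contractive_functionals" "l y = complex_of_real (norm y)"
      using support_functional_exists[of y] unfolding contractive_functionals_def by blast
    then show ?thesis using le[of l] by simp
  qed
  then show ?thesis unfolding norming_def contractive_functionals_def by blast
qed

text \<open>For operators, functionals of the form \<open>T \<mapsto> l (T k)\<close> suffice. Composed with \<^term>\<open>fderiv f\<close> they give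
  scalar functions, whose holomorphy can be checked by hand; this would fail for an arbitrary functional
  on the space of operators.\<close>

lemma norming_blinfun_evaluations:
  "norming {\<lambda>T :: 'a::complex_normed_vector \<Rightarrow>\<^sub>L 'b::complex_normed_vector. l (T k) |l k.
     l \<in> contractive_functionals \<and> norm k \<le> 1}" (is "norming ?\<Lambda>")
proof -
  have "bounded_clinear L \<and> (\<forall>T. cmod (L T) \<le> norm T)" if L: "L \<in> ?\<Lambda>" for L
  proof -
    obtain l k where L: "L = (\<lambda>T. l (T k))" and l: "bounded_clinear l" "\<And>y. cmod (l y) \<le> norm y"
      and k: "norm k \<le> 1"
      using L unfolding contractive_functionals_def by blast
    have "cmod (L T) \<le> norm T" for T
    proof -
      have "cmod (L T) \<le> norm (T k)" unfolding L by (rule l)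
      also have "\<dots> \<le> norm T * norm k" by (rule norm_blinfun)
      also have "\<dots> \<le> norm T" using k by (simp add: mult_left_le)
      finally show ?thesis .
    qed
    moreover have "bounded_linear L"
      unfolding L using l(1) unfolding bounded_clinear_def
      by (auto intro: bounded_linear_compose[OF _ bounded_linear_apply_blinfun] bounded_linear_intros)
    moreover have "L (c *\<^sub>C T) = c *\<^sub>C L T" for c T
      unfolding L by (simp add: scaleC_blinfun.rep_eq bounded_clinearD(3)[OF l(1)])
    ultimately show ?thesis by (simp add: bounded_clinear_def)
  qed
  moreover have "norm T \<le> c" if le: "\<And>L. L \<in> ?\<Lambda> \<Longrightarrow> cmod (L T) \<le> c" for T c
  proof -
    have Tk: "norm (T k) \<le> c" if "norm k \<le> 1" for k
    proof -
      have "\<forall>l\<in>contractive_functionals. cmod (l (T k)) \<le> c" using le that by blast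
      then show ?thesis using norming_contractive_functionals unfolding norming_def by blast
    qed
    have c: "0 \<le> c" using Tk[of 0] by simp
    show ?thesis
    proof (rule norm_blinfun_bound[OF c])
      fix x
      show "norm (T x) \<le> c * norm x"
      proof (cases "x = 0")
        case False
        have "norm (T ((1 / norm x) *\<^sub>R x)) \<le> c" by (rule Tk) (use False in simp)
        then show ?thesis using False by (simp add: blinfun.scaleR_right field_simps)
      qed simp
    qed
  qed
  ultimately show ?thesis unfolding norming_def by (metis (no_types, lifting))
qed

text \<open>Complex linearity passes to \<^const>\<open>fderiv\<close> because the Frechet derivative is unique.\<close>

lemma has_derivative_fderiv:
  assumes "fholomorphic_on f S" "z \<in> S"
  shows "(f has_derivative fderiv f z) (at z)" "bounded_clinear (fderiv f z)"
proof -
  obtain D where D: "bounded_clinear D" "(f has_derivative D) (at z)"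
    using assms unfolding fholomorphic_on_def by blast
  have "blinfun_apply (fderiv f z) = D"
    unfolding fderiv_def frechet_derivative_at[OF D(2), symmetric]
    by (rule bounded_linear_Blinfun_apply) (rule has_derivative_bounded_linear[OF D(2)])
  with D show "(f has_derivative fderiv f z) (at z)" "bounded_clinear (fderiv f z)" by simp_all
qed

lemma bounded_linear_scaleC_left: "bounded_linear (\<lambda>c. c *\<^sub>C (x::'a::complex_normed_vector))"
  by (rule bounded_linear_intro[where K = "norm x"])
    (simp_all add: scaleC_add_left scaleR_eq_scaleC[symmetric, where 'a = 'a] scaleC_scaleC[symmetric] norm_scaleC scaleR_conv_of_real)

lemma field_derivative_along_line:
  assumes f: "fholomorphic_on f S" and z: "z + s *\<^sub>C h \<in> S" and l: "bounded_clinear l"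
  shows "((\<lambda>s. l (f (z + s *\<^sub>C h))) has_field_derivative l (fderiv f (z + s *\<^sub>C h) h)) (at s)"
proof -
  have bl: "bounded_linear l" using l by (simp add: bounded_clinear_def)
  have 1: "((\<lambda>s. z + s *\<^sub>C h) has_derivative (\<lambda>t. t *\<^sub>C h)) (at s)"
    by (auto intro!: derivative_eq_intros bounded_linear_imp_has_derivative[OF bounded_linear_scaleC_left])
  have "((\<lambda>s. l (f (z + s *\<^sub>C h))) has_derivative (\<lambda>t. l (fderiv f (z + s *\<^sub>C h) (t *\<^sub>C h)))) (at s)"
    by (rule bounded_linear.has_derivative[OF bl])
      (rule has_derivative_compose[OF 1 has_derivative_fderiv(1)[OF f z]])
  moreover have "(\<lambda>t. l (fderiv f (z + s *\<^sub>C h) (t *\<^sub>C h))) = (*) (l (fderiv f (z + s *\<^sub>C h) h))"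
    by (simp add: fun_eq_iff bounded_clinearD(3)[OF has_derivative_fderiv(2)[OF f z]]
        bounded_clinearD(3)[OF l] scaleC_complex_def mult.commute)
  ultimately show ?thesis by (simp add: has_field_derivative_def)
qed

lemma open_line: "open S \<Longrightarrow> open {s. z + s *\<^sub>C (h::'a::complex_normed_vector) \<in> S}"
proof -
  assume S: "open S"
  have "continuous_on UNIV (\<lambda>s. z + s *\<^sub>C h)"
    by (intro continuous_on_add continuous_on_const continuous_on_id
        bounded_linear.continuous_on[OF bounded_linear_scaleC_left])
  from open_vimage[OF S this] show ?thesis by (simp add: vimage_def)
qed

lemma holomorphic_along_line:
  assumes "fholomorphic_on f S" "bounded_clinear l"
  shows "(\<lambda>s. l (f (z + s *\<^sub>C h))) holomorphic_on {s. z + s *\<^sub>C h \<in> S}"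
  unfolding holomorphic_on_def field_differentiable_def
  using field_derivative_along_line[OF assms(1) _ assms(2)] has_field_derivative_at_within by blast

text \<open>The criterion applies to \<open>fderiv f\<close> with the norming set of evaluations. Local boundedness follows from
  that of \<open>f\<close> by the estimate for the first Taylor coefficient. The function
  \<open>s \<mapsto> l (fderiv f (z + s *\<^sub>C h) k)\<close> is holomorphic since it is the uniform limit, by the estimate for the
  second coefficient, of the difference quotients of \<open>l \<circ> f\<close> in the direction \<open>k\<close>.\<close>

theorem fholomorphic_fderiv:
  fixes f :: "'a::complex_normed_vector \<Rightarrow> 'b::complex_banach"
  assumes S: "open S" and f: "fholomorphic_on f S"
  shows "fholomorphic_on (fderiv f) S"
  unfolding fholomorphic_on_def
proof
  fix z\<^sub>0 assume z0: "z\<^sub>0 \<in> S"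
  have "isCont f z\<^sub>0"
    using has_derivative_continuous[OF has_derivative_fderiv(1)[OF f z0]] .
  then obtain d where d: "0 < d" "\<And>z. dist z z\<^sub>0 < d \<Longrightarrow> dist (f z) (f z\<^sub>0) < 1"
    unfolding continuous_at_eps_delta by (metis zero_less_one)
  obtain e where e: "0 < e" "ball z\<^sub>0 e \<subseteq> S" using S z0 open_contains_ball by blast
  define R where "R = min d e / 4"
  have R: "0 < R" using d(1) e(1) by (simp add: R_def)
  define M where "M = norm (f z\<^sub>0) + 1"
  have sub: "ball z\<^sub>0 (4 * R) \<subseteq> S" using e by (auto simp: R_def)
  have M: "norm (f z) \<le> M" if "z \<in> ball z\<^sub>0 (4 * R)" for z
  proof -
    have "dist (f z) (f z\<^sub>0) < 1" using that by (intro d) (auto simp: R_def dist_commute)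
    then show ?thesis using norm_triangle_ineq2[of "f z" "f z\<^sub>0"] by (simp add: M_def dist_norm)
  qed
  have inb: "z + t *\<^sub>C k \<in> ball z\<^sub>0 (4 * R)" if "z \<in> ball z\<^sub>0 (2 * R)" "norm k \<le> 1" "cmod t < 2 * R" for z k t
  proof -
    have "norm (t *\<^sub>C k) < 2 * R"
      using that(2,3) mult_left_le[of "norm k" "cmod t"] by (simp add: norm_scaleC)
    then show ?thesis using that(1) norm_triangle_ineq4[of "z\<^sub>0 - z" "t *\<^sub>C k"]
      by (simp add: dist_norm diff_diff_eq)
  qed
  \<comment> \<open>Estimates for the first two Taylor coefficients of \<open>l \<circ> f\<close>, uniform over all complex lines.\<close>
  have Cauchy: "cmod (l (fderiv f z k)) \<le> M / R"
    "cmod t < 2 * R \<Longrightarrow> cmod (l (f (z + t *\<^sub>C k)) - l (f z) - t * l (fderiv f z k)) \<le> M / R\<^sup>2 * (cmod t)\<^sup>2"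
    if l: "l \<in> contractive_functionals" and z: "z \<in> ball z\<^sub>0 (2 * R)" and k: "norm k \<le> 1" for l z k t
  proof -
    have l': "bounded_clinear l" "\<And>y. cmod (l y) \<le> norm y"
      using l by (auto simp: contractive_functionals_def)
    define \<phi> where "\<phi> t = l (f (z + t *\<^sub>C k))" for t
    have "\<phi> holomorphic_on ball 0 (2 * R)"
      unfolding \<phi>_def by (rule holomorphic_on_subset[OF holomorphic_along_line[OF f l'(1)]])
        (use inb[OF z k] sub in auto)
    moreover have "cmod (\<phi> t) \<le> M" if "cmod t < 2 * R" for t
      unfolding \<phi>_def using l'(2) M[OF inb[OF z k that]] order_trans by blast
    ultimately obtain \<delta> where \<delta>: "\<And>t. cmod t < 2 * R \<Longrightarrow> \<phi> t = \<phi> 0 + t * \<delta> t" "deriv \<phi> 0 = \<delta> 0"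
      "\<And>t. cmod t < 2 * R \<Longrightarrow> cmod (\<delta> t) \<le> 2 * M / (2 * R)"
      "\<And>t. cmod t < 2 * R \<Longrightarrow> cmod (\<delta> t - \<delta> 0) \<le> 4 * M / (2 * R)\<^sup>2 * cmod t"
      using Schwarz_slope[of \<phi> "2 * R" M] R by (metis mult_pos_pos zero_less_numeral)
    have "z + 0 *\<^sub>C k \<in> S" using z sub R by (auto simp: scaleC_zero_left)
    from field_derivative_along_line[OF f this l'(1)]
    have D: "l (fderiv f z k) = \<delta> 0"
      unfolding \<delta>(2)[symmetric] \<phi>_def by (simp add: DERIV_imp_deriv scaleC_zero_left)
    show "cmod (l (fderiv f z k)) \<le> M / R" using D \<delta>(3)[of 0] R by simp
    show "cmod (l (f (z + t *\<^sub>C k)) - l (f z) - t * l (fderiv f z k)) \<le> M / R\<^sup>2 * (cmod t)\<^sup>2"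
      if t: "cmod t < 2 * R"
    proof -
      have "l (f (z + t *\<^sub>C k)) - l (f z) - t * l (fderiv f z k) = t * (\<delta> t - \<delta> 0)"
        using \<delta>(1)[OF t] D by (simp add: \<phi>_def scaleC_zero_left algebra_simps)
      then have "cmod (l (f (z + t *\<^sub>C k)) - l (f z) - t * l (fderiv f z k)) = cmod t * cmod (\<delta> t - \<delta> 0)"
        by (simp add: norm_mult)
      also have "\<dots> \<le> cmod t * (4 * M / (2 * R)\<^sup>2 * cmod t)"
        by (intro mult_left_mono \<delta>(4) t) simp
      also have "\<dots> = M / R\<^sup>2 * (cmod t)\<^sup>2" by (simp add: power2_eq_square)
      finally show ?thesis .
    qed
  qed
  show "\<exists>D. bounded_clinear D \<and> (fderiv f has_derivative D) (at z\<^sub>0)"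
  proof (rule weakly_holomorphic_imp_frechet[OF R _ norming_blinfun_evaluations])
    fix z assume z: "z \<in> ball z\<^sub>0 (2 * R)"
    have "\<forall>L\<in>{\<lambda>T :: 'a \<Rightarrow>\<^sub>L 'b. l (T k) |l k. l \<in> contractive_functionals \<and> norm k \<le> 1}. cmod (L (fderiv f z)) \<le> M / R"
      using Cauchy(1)[OF _ z] by blast
    then show "norm (fderiv f z) \<le> M / R"
      using norming_blinfun_evaluations unfolding norming_def by blast
  next
    fix L z h assume "L \<in> {\<lambda>T :: 'a \<Rightarrow>\<^sub>L 'b. l (T k) |l k. l \<in> contractive_functionals \<and> norm k \<le> 1}"
    then obtain l k where L: "L = (\<lambda>T. l (T k))" and l: "l \<in> contractive_functionals" and k: "norm k \<le> 1"
      by blast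
    have l': "bounded_clinear l" using l by (simp add: contractive_functionals_def)
    define O' where "O' = {s. z + s *\<^sub>C h \<in> ball z\<^sub>0 (2 * R)}"
    have O': "open O'" unfolding O'_def by (rule open_line) simp
    \<comment> \<open>\<open>N\<close> makes the steps \<open>u n\<close> smaller than \<open>2 * R\<close> for all \<open>n\<close>.\<close>
    obtain N :: nat where N: "1 / real (Suc N) < 2 * R"
      using reals_Archimedean[of "2 * R"] R by (auto simp: inverse_eq_divide)
    define u where "u n = 1 / real (Suc (N + n))" for n
    have u0: "0 < u n" for n by (simp add: u_def)
    have uR: "u n < 2 * R" for n
      by (rule le_less_trans[OF _ N]) (simp add: u_def frac_le)
    have ulim: "u \<longlonglongrightarrow> 0"
      unfolding u_def using LIMSEQ_ignore_initial_segment[OF LIMSEQ_inverse_real_of_nat, of N]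
      by (simp add: inverse_eq_divide add.commute)
    define \<phi> where "\<phi> n s = (l (f (z + of_real (u n) *\<^sub>C k + s *\<^sub>C h)) - l (f (z + s *\<^sub>C h))) / of_real (u n)" for n s
    have in4: "z + of_real (u n) *\<^sub>C k + s *\<^sub>C h \<in> ball z\<^sub>0 (4 * R)" if "s \<in> O'" for s n
      using inb[of "z + s *\<^sub>C h" k "of_real (u n)"] that k u0[of n] uR[of n] by (simp add: O'_def add_ac)
    have "(\<lambda>s. l (fderiv f (z + s *\<^sub>C h) k)) holomorphic_on O'"
    proof (rule holomorphic_uniform_sequence[OF O'])
      fix n
      show "\<phi> n holomorphic_on O'"
        unfolding \<phi>_def
      proof (intro holomorphic_intros holomorphic_on_subset[OF holomorphic_along_line[OF f l']])
        show "O' \<subseteq> {s. z + of_real (u n) *\<^sub>C k + s *\<^sub>C h \<in> S}" using in4 sub by blast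
        show "O' \<subseteq> {s. z + s *\<^sub>C h \<in> S}" using sub R by (auto simp: O'_def)
        show "of_real (u n) \<noteq> (0::complex)" using u0[of n] by simp
      qed
    next
      fix x assume "x \<in> O'"
      then obtain d where d: "0 < d" "cball x d \<subseteq> O'" using O' open_contains_cball by blast
      have est: "cmod (\<phi> n s - l (fderiv f (z + s *\<^sub>C h) k)) \<le> M / R\<^sup>2 * u n" if s: "s \<in> O'" for n s
      proof -
        have "cmod (l (f (z + s *\<^sub>C h + of_real (u n) *\<^sub>C k)) - l (f (z + s *\<^sub>C h))
            - of_real (u n) * l (fderiv f (z + s *\<^sub>C h) k)) \<le> M / R\<^sup>2 * (cmod (of_real (u n)))\<^sup>2"
          by (rule Cauchy(2)[OF l _ k]) (use s u0[of n] uR[of n] in \<open>auto simp: O'_def\<close>)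
        moreover have "l (f (z + s *\<^sub>C h + of_real (u n) *\<^sub>C k)) - l (f (z + s *\<^sub>C h))
            - of_real (u n) * l (fderiv f (z + s *\<^sub>C h) k)
            = of_real (u n) * (\<phi> n s - l (fderiv f (z + s *\<^sub>C h) k))"
          using u0[of n] by (simp add: \<phi>_def field_simps add_ac)
        ultimately have "u n * cmod (\<phi> n s - l (fderiv f (z + s *\<^sub>C h) k)) \<le> u n * (M / R\<^sup>2 * u n)"
          using u0[of n] by (simp add: norm_mult power2_eq_square mult_ac)
        then show ?thesis by (rule mult_left_le_imp_le) (rule u0)
      qed
      have "uniform_limit O' \<phi> (\<lambda>s. l (fderiv f (z + s *\<^sub>C h) k)) sequentially"
      proof (rule uniform_limitI)
        fix e :: real assume e: "0 < e"
        have "(\<lambda>n. M / R\<^sup>2 * u n) \<longlonglongrightarrow> M / R\<^sup>2 * 0" by (intro tendsto_intros ulim)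
        then have "\<forall>\<^sub>F n in sequentially. M / R\<^sup>2 * u n < e" using e by (intro order_tendstoD) auto
        then show "\<forall>\<^sub>F n in sequentially. \<forall>s\<in>O'. dist (\<phi> n s) (l (fderiv f (z + s *\<^sub>C h) k)) < e"
          by eventually_elim (use est in \<open>auto simp: dist_norm intro: le_less_trans\<close>)
      qed
      then show "\<exists>d. 0 < d \<and> cball x d \<subseteq> O' \<and>
          uniform_limit (cball x d) \<phi> (\<lambda>s. l (fderiv f (z + s *\<^sub>C h) k)) sequentially"
        using d uniform_limit_on_subset by blast
    qed
    then show "(\<lambda>s. L (fderiv f (z + s *\<^sub>C h))) holomorphic_on {s. z + s *\<^sub>C h \<in> ball z\<^sub>0 (2 * R)}"
      by (simp add: L O'_def)
  qed
qed

section \<open>Coefficients of bounded holomorphic functions\<close>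

text \<open>Turns a functional equation on the disc into an identity of formal power series, from which coefficients
  can be read off.\<close>

lemma fps_expansions_eqI:
  assumes "f has_fps_expansion F" "g has_fps_expansion G"
    and eq: "\<And>z::complex. cmod z < 1 \<Longrightarrow> f z = (g z :: complex)"
  shows "F = G"
proof -
  have "\<forall>\<^sub>F z in nhds 0. f z = g z"
    using eventually_nhds_in_open[of "ball 0 1" "0::complex"] by (auto elim!: eventually_mono simp: eq)
  then have "g has_fps_expansion F" using assms(1) has_fps_expansion_cong[of f g F F] by simp
  then show ?thesis using assms(2) by (rule fps_expansion_unique_complex)
qed

lemma holomorphic_has_fps_expansion:
  "f holomorphic_on ball 0 1 \<Longrightarrow> f has_fps_expansion fps_expansion f 0"
  by (rule has_fps_expansion_fps_expansion[of "ball 0 1"]) auto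

text \<open>One step of the Schur algorithm: the Moebius transformation that sends \<open>h 0\<close> to \<open>0\<close> is applied to \<open>h\<close>, and
  the zero at the origin is divided out by the Schwarz lemma.\<close>

lemma Schur_step:
  assumes hol: "h holomorphic_on ball 0 1" and le: "\<And>z. cmod z < 1 \<Longrightarrow> cmod (h z) \<le> 1"
    and h0: "cmod (h 0) < 1"
  obtains h\<^sub>1 where "h\<^sub>1 holomorphic_on ball 0 1" "\<And>z. cmod z < 1 \<Longrightarrow> cmod (h\<^sub>1 z) \<le> 1"
    "\<And>z. cmod z < 1 \<Longrightarrow> h z - h 0 = z * h\<^sub>1 z * (1 - cnj (h 0) * h z)"
proof -
  have lt: "cmod (h z) < 1" if z: "cmod z < 1" for z
  proof (rule ccontr)
    assume "\<not> cmod (h z) < 1"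
    then have "cmod (h z) = 1" using le[OF z] by simp
    then have "h constant_on ball 0 1"
      using z le by (intro maximum_modulus_principle[OF hol, of "ball 0 1" z]) auto
    then have "h z = h 0" using z unfolding constant_on_def by auto
    then show False using h0 \<open>cmod (h z) = 1\<close> by simp
  qed
  define m where "m z = Moebius_function 0 (h 0) (h z)" for z
  have m: "m holomorphic_on ball 0 1"
  proof -
    have "h ` ball 0 1 \<subseteq> ball 0 1" using lt by auto
    from holomorphic_on_compose_gen[OF hol Moebius_function_holomorphic[OF h0, of 0] this]
    show ?thesis unfolding m_def o_def .
  qed
  have m0: "m 0 = 0" by (simp add: m_def Moebius_function_eq_zero)
  have mlt: "cmod (m z) < 1" if "cmod z < 1" for z
    unfolding m_def by (rule Moebius_function_norm_lt_1[OF h0 lt[OF that]])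
  obtain k where k: "k holomorphic_on ball 0 1" "\<And>z. cmod z < 1 \<Longrightarrow> m z = z * k z" "deriv m 0 = k 0"
    using Schwarz3[OF m m0] by blast
  have "cmod (k z) \<le> 1" if z: "cmod z < 1" for z
  proof (cases "z = 0")
    case True
    then show ?thesis using Schwarz_Lemma(2)[OF m m0 mlt z] k(3) by simp
  next
    case False
    then show ?thesis using Schwarz_Lemma(1)[OF m m0 mlt z] k(2)[OF z] by (simp add: norm_mult)
  qed
  moreover have "h z - h 0 = z * k z * (1 - cnj (h 0) * h z)" if z: "cmod z < 1" for z
  proof -
    have "cmod (cnj (h 0) * h z) < 1"
      using h0 lt[OF z] mult_strict_mono'[of "cmod (h 0)" 1 "cmod (h z)" 1] by (simp add: norm_mult)
    then have "1 - cnj (h 0) * h z \<noteq> 0" by auto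
    then show ?thesis unfolding k(2)[OF z, symmetric] m_def Moebius_function_simple by simp
  qed
  ultimately show ?thesis using that k(1) by blast
qed

text \<open>The degenerate case of the Schur algorithm, settled by the maximum modulus principle.\<close>

lemma bounded_unimodular_constant:
  assumes hol: "h holomorphic_on ball 0 1" and le: "\<And>z. cmod z < 1 \<Longrightarrow> cmod (h z) \<le> 1"
    and h0: "cmod (h 0) \<ge> 1" and H: "h has_fps_expansion H" and n: "0 < n"
  shows "fps_nth H n = 0"
proof -
  have "h constant_on ball 0 1"
    by (rule maximum_modulus_principle[OF hol, of "ball 0 1" 0]) (use le h0 in \<open>auto intro: order_trans\<close>)
  then obtain c where "\<And>z. cmod z < 1 \<Longrightarrow> h z = c" unfolding constant_on_def by auto
  then have "H = fps_const c"
    by (intro fps_expansions_eqI[OF H has_fps_expansion_const]) auto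
  then show ?thesis using n by simp
qed

lemma Schur_step_fps:
  assumes hol: "h holomorphic_on ball 0 1" and le: "\<And>z. cmod z < 1 \<Longrightarrow> cmod (h z) \<le> 1"
    and H: "h has_fps_expansion H" and h0: "cmod (fps_nth H 0) < 1"
  obtains g G where "g holomorphic_on ball 0 1" "\<And>z. cmod z < 1 \<Longrightarrow> cmod (g z) \<le> 1"
    "g has_fps_expansion G"
    "fps_nth H 1 = of_real (1 - (cmod (fps_nth H 0))\<^sup>2) * fps_nth G 0"
    "fps_nth H 2 = of_real (1 - (cmod (fps_nth H 0))\<^sup>2) *
      (fps_nth G 1 - cnj (fps_nth H 0) * (fps_nth G 0)\<^sup>2)"
proof -
  have b: "h 0 = fps_nth H 0" by (rule has_fps_expansion_imp_0_eq_fps_nth_0[OF H])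
  define b where "b = fps_nth H 0"
  obtain g where g: "g holomorphic_on ball 0 1" "\<And>z. cmod z < 1 \<Longrightarrow> cmod (g z) \<le> 1"
    "\<And>z. cmod z < 1 \<Longrightarrow> h z - b = z * g z * (1 - cnj b * h z)"
    using Schur_step[OF hol le] h0 unfolding b b_def by blast
  define G where "G = fps_expansion g 0"
  have G: "g has_fps_expansion G"
    unfolding G_def by (rule holomorphic_has_fps_expansion[OF g(1)])
  have eq: "H - fps_const b = fps_X * G * (1 - fps_const (cnj b) * H)"
    by (rule fps_expansions_eqI[OF has_fps_expansion_diff[OF H has_fps_expansion_const]
        has_fps_expansion_mult[OF has_fps_expansion_mult[OF has_fps_expansion_fps_X G]
          has_fps_expansion_diff[OF has_fps_expansion_1
            has_fps_expansion_mult[OF has_fps_expansion_const H]]] g(3)])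
  have bb: "1 - cnj b * b = of_real (1 - (cmod b)\<^sup>2)"
    using complex_norm_square[of b] by (simp add: mult.commute)
  have H1: "fps_nth H 1 = of_real (1 - (cmod b)\<^sup>2) * fps_nth G 0"
    using arg_cong[OF eq, of "\<lambda>F. fps_nth F 1"] unfolding bb[symmetric]
    by (simp add: fps_mult_nth b_def mult.assoc mult.commute)
  have "fps_nth H 2 = fps_nth G 1 * (1 - cnj b * b) - fps_nth G 0 * (cnj b * fps_nth H 1)"
    using arg_cong[OF eq, of "\<lambda>F. fps_nth F 2"]
    by (simp add: fps_mult_nth b_def[symmetric] numeral_2_eq_2 algebra_simps)
  then have "fps_nth H 2 = of_real (1 - (cmod b)\<^sup>2) * (fps_nth G 1 - cnj b * (fps_nth G 0)\<^sup>2)"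
    unfolding bb H1 by (simp add: algebra_simps power2_eq_square)
  from that[OF g(1,2) G H1[unfolded b_def] this[unfolded b_def]] show ?thesis by simp
qed

text \<open>The Schwarz--Pick inequality at the origin.\<close>

lemma bounded_function_first_coeff:
  assumes hol: "h holomorphic_on ball 0 1" and le: "\<And>z. cmod z < 1 \<Longrightarrow> cmod (h z) \<le> 1"
    and H: "h has_fps_expansion H"
  shows "cmod (fps_nth H 1) \<le> 1 - (cmod (fps_nth H 0))\<^sup>2"
proof (cases "cmod (fps_nth H 0) < 1")
  case False
  have b: "h 0 = fps_nth H 0" by (rule has_fps_expansion_imp_0_eq_fps_nth_0[OF H])
  then have "cmod (h 0) = 1" using le[of 0] False by simp
  then show ?thesis using bounded_unimodular_constant[OF hol le _ H, of 1] b by simp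
next
  case True
  then obtain g G where g: "\<And>z. cmod z < 1 \<Longrightarrow> cmod (g z) \<le> 1" "g has_fps_expansion G"
    and H1: "fps_nth H 1 = of_real (1 - (cmod (fps_nth H 0))\<^sup>2) * fps_nth G 0"
    using Schur_step_fps[OF hol le H] by metis
  have "cmod (fps_nth G 0) \<le> 1"
    using g(1)[of 0] has_fps_expansion_imp_0_eq_fps_nth_0[OF g(2)] by simp
  moreover have "0 \<le> 1 - (cmod (fps_nth H 0))\<^sup>2" using True by (simp add: power_le_one)
  ultimately show ?thesis
    unfolding H1 norm_mult norm_of_real by (simp only: abs_of_nonneg mult_left_le)
qed

text \<open>The Schur step gives the second coefficient as \<open>(1 - \<bar>b\<^sub>0\<bar>\<^sup>2) (g\<^sub>1 - cnj b\<^sub>0 * g\<^sub>0\<^sup>2)\<close>, and the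
  Schwarz--Pick inequality \<open>\<bar>g\<^sub>1\<bar> \<le> 1 - \<bar>g\<^sub>0\<bar>\<^sup>2\<close> for the next Schur function bounds the last
  factor by 1.\<close>

lemma bounded_function_second_coeff:
  assumes hol: "h holomorphic_on ball 0 1" and le: "\<And>z. cmod z < 1 \<Longrightarrow> cmod (h z) \<le> 1"
    and H: "h has_fps_expansion H"
  shows "cmod (fps_nth H 2) \<le> 1 - (cmod (fps_nth H 0))\<^sup>2"
proof (cases "cmod (fps_nth H 0) < 1")
  case False
  have b: "h 0 = fps_nth H 0" by (rule has_fps_expansion_imp_0_eq_fps_nth_0[OF H])
  then have "cmod (h 0) = 1" using le[of 0] False by simp
  then show ?thesis using bounded_unimodular_constant[OF hol le _ H, of 2] b by simp
next
  case True
  then obtain g G where g: "g holomorphic_on ball 0 1" "\<And>z. cmod z < 1 \<Longrightarrow> cmod (g z) \<le> 1"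
      "g has_fps_expansion G"
    and H2: "fps_nth H 2 = of_real (1 - (cmod (fps_nth H 0))\<^sup>2) *
      (fps_nth G 1 - cnj (fps_nth H 0) * (fps_nth G 0)\<^sup>2)"
    using Schur_step_fps[OF hol le H] by metis
  have "cmod (fps_nth G 1 - cnj (fps_nth H 0) * (fps_nth G 0)\<^sup>2)
      \<le> cmod (fps_nth G 1) + cmod (fps_nth H 0) * (cmod (fps_nth G 0))\<^sup>2"
    by (rule order_trans[OF norm_triangle_ineq4]) (simp add: norm_mult norm_power)
  also have "\<dots> \<le> (1 - (cmod (fps_nth G 0))\<^sup>2) + 1 * (cmod (fps_nth G 0))\<^sup>2"
    using True by (intro add_mono mult_right_mono bounded_function_first_coeff[OF g]) auto
  finally have "cmod (fps_nth G 1 - cnj (fps_nth H 0) * (fps_nth G 0)\<^sup>2) \<le> 1" by simp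
  moreover have "0 \<le> 1 - (cmod (fps_nth H 0))\<^sup>2" using True by (simp add: power_le_one)
  ultimately show ?thesis
    unfolding H2 norm_mult norm_of_real by (simp only: abs_of_nonneg mult_left_le)
qed

lemma Schwarz_function_coeffs:
  assumes hol: "w holomorphic_on ball 0 1" and w0: "w 0 = 0" and lt: "\<And>z. cmod z < 1 \<Longrightarrow> cmod (w z) < 1"
    and W: "w has_fps_expansion W"
  shows "cmod (fps_nth W 1) \<le> 1" "cmod (fps_nth W 2) \<le> 1 - (cmod (fps_nth W 1))\<^sup>2"
    "cmod (fps_nth W 3) \<le> 1 - (cmod (fps_nth W 1))\<^sup>2"
proof -
  obtain h where h: "h holomorphic_on ball 0 1" "\<And>z. cmod z < 1 \<Longrightarrow> w z = z * h z" "deriv w 0 = h 0"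
    using Schwarz3[OF hol w0] by blast
  have le: "cmod (h z) \<le> 1" if z: "cmod z < 1" for z
    using Schwarz_Lemma(1,2)[OF hol w0 lt z] h(3) h(2)[OF z] by (cases "z = 0") (auto simp: norm_mult)
  define H where "H = fps_expansion h 0"
  have H: "h has_fps_expansion H" unfolding H_def by (rule holomorphic_has_fps_expansion[OF h(1)])
  have "W = fps_X * H"
    by (rule fps_expansions_eqI[OF W _ h(2)]) (intro fps_expansion_intros H)
  then have W: "fps_nth W 1 = fps_nth H 0" "fps_nth W 2 = fps_nth H 1" "fps_nth W 3 = fps_nth H 2"
    by (simp_all add: numeral_2_eq_2 numeral_3_eq_3)
  show "cmod (fps_nth W 1) \<le> 1"
    using le[of 0] has_fps_expansion_imp_0_eq_fps_nth_0[OF H] W by simp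
  show "cmod (fps_nth W 2) \<le> 1 - (cmod (fps_nth W 1))\<^sup>2" "cmod (fps_nth W 3) \<le> 1 - (cmod (fps_nth W 1))\<^sup>2"
    using bounded_function_first_coeff[OF h(1) le H] bounded_function_second_coeff[OF h(1) le H]
    by (simp_all only: W)
qed

section \<open>The Toeplitz determinant of a strongly starlike function\<close>

text \<open>The differential equation for \<open>P\<close> is the logarithmic derivative of \<open>P = ((1 + W) / (1 - W)) powr b\<close>, which
  avoids composing power series with a fractional power. The one for \<open>S\<close> says that the starlike function
  \<open>X * S\<close> has logarithmic derivative \<open>P / X\<close>.\<close>

lemma strongly_starlike_coeffs:
  fixes P W S :: "complex fps" and b :: complex
  assumes P0: "fps_nth P 0 = 1" and W0: "fps_nth W 0 = 0" and S0: "fps_nth S 0 = 1"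
    and PW: "fps_deriv P * (1 - W * W) = fps_const (2 * b) * fps_deriv W * P"
    and PS: "S + fps_X * fps_deriv S = P * S"
  defines "c\<^sub>1 \<equiv> fps_nth W 1" and "c\<^sub>2 \<equiv> fps_nth W 2" and "c\<^sub>3 \<equiv> fps_nth W 3"
  shows "fps_nth S 1 = 2 * b * c\<^sub>1"
    and "fps_nth S 2 = b * c\<^sub>2 + 3 * b\<^sup>2 * c\<^sub>1\<^sup>2"
    and "fps_nth S 3 = 2 * b / 3 * (c\<^sub>3 + 5 * b * c\<^sub>1 * c\<^sub>2 + (17 * b\<^sup>2 + 1) / 3 * c\<^sub>1 ^ 3)"
proof -
  have P1: "fps_nth P 1 = 2 * b * c\<^sub>1"
    using arg_cong[OF PW, of "\<lambda>F. fps_nth F 0"] by (simp add: P0 W0 c\<^sub>1_def)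
  have P2: "2 * fps_nth P 2 = 2 * (2 * b * c\<^sub>2 + 2 * b\<^sup>2 * c\<^sub>1\<^sup>2)"
    using arg_cong[OF PW, of "\<lambda>F. fps_nth F 1"] P1
    by (simp add: fps_mult_nth P0 W0 c\<^sub>1_def c\<^sub>2_def numeral_2_eq_2 algebra_simps)
  then have P2: "fps_nth P 2 = 2 * b * c\<^sub>2 + 2 * b\<^sup>2 * c\<^sub>1\<^sup>2" by (simp only: mult_cancel_left) simp
  have P3: "3 * fps_nth P 3 = 6 * b * c\<^sub>3 + 12 * b\<^sup>2 * c\<^sub>1 * c\<^sub>2 + (2 * b + 4 * b ^ 3) * c\<^sub>1 ^ 3"
    using arg_cong[OF PW, of "\<lambda>F. fps_nth F 2"] P1 P2
    by (simp add: fps_mult_nth P0 W0 c\<^sub>1_def c\<^sub>2_def c\<^sub>3_def numeral_2_eq_2 numeral_3_eq_3 algebra_simps)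
  show S1: "fps_nth S 1 = 2 * b * c\<^sub>1"
    using arg_cong[OF PS, of "\<lambda>F. fps_nth F 1"] P1 by (simp add: fps_mult_nth P0 S0 algebra_simps)
  have "2 * fps_nth S 2 = 2 * (b * c\<^sub>2 + 3 * b\<^sup>2 * c\<^sub>1\<^sup>2)"
    using arg_cong[OF PS, of "\<lambda>F. fps_nth F 2"] P1 P2 S1
    by (simp add: fps_mult_nth P0 S0 numeral_2_eq_2 algebra_simps power2_eq_square)
  then show S2: "fps_nth S 2 = b * c\<^sub>2 + 3 * b\<^sup>2 * c\<^sub>1\<^sup>2" by (simp only: mult_cancel_left) simp
  have "3 * fps_nth S 3 = fps_nth P 3 + 6 * b\<^sup>2 * c\<^sub>1 * c\<^sub>2 + 10 * b ^ 3 * c\<^sub>1 ^ 3"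
    using arg_cong[OF PS, of "\<lambda>F. fps_nth F 3"] P1 P2 S1 S2
    by (simp add: fps_mult_nth P0 S0 numeral_2_eq_2 numeral_3_eq_3 algebra_simps power2_eq_square)
  with P3 have "9 * fps_nth S 3
      = 6 * b * c\<^sub>3 + 30 * b\<^sup>2 * c\<^sub>1 * c\<^sub>2 + (2 * b + 34 * b ^ 3) * c\<^sub>1 ^ 3"
    by algebra
  then show "fps_nth S 3 = 2 * b / 3 * (c\<^sub>3 + 5 * b * c\<^sub>1 * c\<^sub>2 + (17 * b\<^sup>2 + 1) / 3 * c\<^sub>1 ^ 3)"
    by (simp add: field_simps power2_eq_square power3_eq_cube)
qed

text \<open>The determinant of the symmetric Toeplitz matrix with first row \<open>(a\<^sub>2, a\<^sub>3, a\<^sub>4)\<close>.\<close>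

definition toeplitz_det :: "complex \<Rightarrow> complex \<Rightarrow> complex \<Rightarrow> complex" where
  "toeplitz_det a\<^sub>2 a\<^sub>3 a\<^sub>4 = a\<^sub>2 ^ 3 - 2 * a\<^sub>2 * a\<^sub>3\<^sup>2 - a\<^sub>2 * a\<^sub>4\<^sup>2 + 2 * a\<^sub>3\<^sup>2 * a\<^sub>4"

lemma toeplitz_det_factor:
  "toeplitz_det a\<^sub>2 a\<^sub>3 a\<^sub>4 = (a\<^sub>2 - a\<^sub>4) * (a\<^sub>2\<^sup>2 - 2 * a\<^sub>3\<^sup>2 + a\<^sub>2 * a\<^sub>4)"
  unfolding toeplitz_det_def by algebra

text \<open>At \<open>c = 1\<close> both sides agree, so the difference is divisible by \<open>1 - c\<close>. The quotient is bounded below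
  in terms of \<open>u = 1 + c + c\<^sup>2\<close> alone, because \<open>c (1 + c) = u - 1\<close> and \<open>3 c \<le> u\<close>.\<close>

lemma first_factor_real_bound:
  fixes b c :: real
  assumes b: "0 < b" and c: "0 \<le> c" "c \<le> 1"
  shows "3 * c + (1 - c\<^sup>2) + 5 * b * c * (1 - c\<^sup>2) + (17 * b\<^sup>2 + 1) / 3 * c ^ 3 \<le> 3 + (17 * b\<^sup>2 + 1) / 3"
proof -
  define u where "u = 1 + c + c\<^sup>2"
  have u: "1 \<le> u" "u \<le> 3" "3 * c \<le> u"
    using c power_le_one[of c 2] sum_power2_ge_zero[of "c - 1" 0]
    by (auto simp: u_def power2_eq_square algebra_simps)
  define T where "T = 17 / 3 * b\<^sup>2 * u + 2 + 5 * b - 5 * b * u"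
  \<comment> \<open>\<open>T\<close> is affine in \<open>u\<close>, and its values at \<open>u = 1\<close> and \<open>u = 3\<close> are the two quadratics below.\<close>
  have "17 * b\<^sup>2 - 10 * b + 2 = 17 * (b - 5 / 17)\<^sup>2 + 9 / 17"
    by (simp add: power2_eq_square algebra_simps)
  then have "0 \<le> 17 * b\<^sup>2 - 10 * b + 2" by simp
  then have "0 \<le> (3 - u) * (17 / 3 * b\<^sup>2 + 2) + (u - 1) * (17 * b\<^sup>2 - 10 * b + 2)"
    using u by simp
  also have "\<dots> = 2 * T" by (simp add: T_def field_simps)
  finally have "0 \<le> T" by simp
  then have "0 \<le> (17 * b\<^sup>2 + 1) / 3 * u + 2 - c - 5 * b * (u - 1)"
    using u(3) by (simp add: T_def field_simps)
  then have "0 \<le> (1 - c) * ((17 * b\<^sup>2 + 1) / 3 * u + 2 - c - 5 * b * (u - 1))"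
    using c by simp
  then show ?thesis by (simp add: u_def power2_eq_square power3_eq_cube field_simps)
qed

text \<open>Both sides agree at \<open>c = 1\<close>, and the difference is \<open>1 - c\<^sup>2\<close> times a nonnegative quantity.\<close>

lemma second_factor_real_bound:
  fixes b c :: real
  assumes b: "1 / 2 \<le> b" and c: "0 \<le> c" "c \<le> 1"
  shows "2 * c\<^sup>2 + (1 - c\<^sup>2)\<^sup>2 + 8 / 3 * b * c\<^sup>2 * (1 - c\<^sup>2) + 2 / 3 * c * (1 - c\<^sup>2)
    + (47 * b\<^sup>2 - 2) / 9 * c ^ 4 \<le> (47 * b\<^sup>2 + 16) / 9"
proof -
  define K where "K = (47 * b\<^sup>2 - 2) / 9"
  have "0 \<le> 47 * (b - 12 / 47)\<^sup>2 + 7 - 144 / 47" by simp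
  then have K: "8 / 3 * b \<le> K + 1" by (simp add: K_def power2_eq_square field_simps)
  have "0 \<le> 1 + K - 2 / 3 * c + (K + 1 - 8 / 3 * b) * c\<^sup>2"
    using K b c mult_nonneg_nonneg[of "K + 1 - 8 / 3 * b" "c\<^sup>2"] by simp
  then have "0 \<le> (1 - c\<^sup>2) * (1 + K - 2 / 3 * c + (K + 1 - 8 / 3 * b) * c\<^sup>2)"
    using c by (intro mult_nonneg_nonneg) (simp_all add: power_le_one)
  then have "2 * c\<^sup>2 + (1 - c\<^sup>2)\<^sup>2 + 8 / 3 * b * c\<^sup>2 * (1 - c\<^sup>2) + 2 / 3 * c * (1 - c\<^sup>2) + K * c ^ 4 \<le> K + 2"
    by (simp add: power2_eq_square power4_eq_xxxx algebra_simps)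
  moreover have "K + 2 = (47 * b\<^sup>2 + 16) / 9" by (simp add: K_def field_simps)
  ultimately show ?thesis by (simp only: K_def)
qed

text \<open>Written in terms of \<open>c\<^sub>1, c\<^sub>2, c\<^sub>3\<close>, each factor of the determinant is estimated term by term. The assumption
  \<open>1 / 2 \<le> \<beta>\<close> makes the coefficient \<open>(47 \<beta>\<^sup>2 - 2) / 9\<close> of \<open>c\<^sub>1 ^ 4\<close> in the second factor nonnegative.\<close>

lemma toeplitz_det_bound:
  fixes c\<^sub>1 c\<^sub>2 c\<^sub>3 :: complex and \<beta> :: real
  assumes \<beta>: "1 / 2 \<le> \<beta>"
    and c1: "cmod c\<^sub>1 \<le> 1" and c2: "cmod c\<^sub>2 \<le> 1 - (cmod c\<^sub>1)\<^sup>2" and c3: "cmod c\<^sub>3 \<le> 1 - (cmod c\<^sub>1)\<^sup>2"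
  defines "b \<equiv> complex_of_real \<beta>"
  defines "a\<^sub>2 \<equiv> 2 * b * c\<^sub>1" and "a\<^sub>3 \<equiv> b * c\<^sub>2 + 3 * b\<^sup>2 * c\<^sub>1\<^sup>2"
    and "a\<^sub>4 \<equiv> 2 * b / 3 * (c\<^sub>3 + 5 * b * c\<^sub>1 * c\<^sub>2 + (17 * b\<^sup>2 + 1) / 3 * c\<^sub>1 ^ 3)"
  shows "cmod (toeplitz_det a\<^sub>2 a\<^sub>3 a\<^sub>4) \<le> 4 / 81 * \<beta> ^ 3 * (17 * \<beta>\<^sup>2 + 10) * (47 * \<beta>\<^sup>2 + 16)"
proof -
  define c where "c = cmod c\<^sub>1"
  have c: "0 \<le> c" "c \<le> 1" using c1 by (auto simp: c_def)
  have \<beta>0: "0 < \<beta>" using \<beta> by simp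
  have b: "cmod b = \<beta>" using \<beta>0 by (simp add: b_def)
  have K: "(47 * b\<^sup>2 - 2) / 9 = of_real ((47 * \<beta>\<^sup>2 - 2) / 9)"
    and N: "(17 * b\<^sup>2 + 1) / 3 = of_real ((17 * \<beta>\<^sup>2 + 1) / 3)" by (simp_all add: b_def)
  have "1 / 4 \<le> \<beta>\<^sup>2" using power_mono[OF \<beta>, of 2] by (simp add: power_divide)
  then have K0: "0 \<le> (47 * \<beta>\<^sup>2 - 2) / 9" by simp
  note c2 = c2[folded c_def] and c3 = c3[folded c_def]
  have "cmod (a\<^sub>2 - a\<^sub>4) \<le> 2 / 9 * \<beta> * (17 * \<beta>\<^sup>2 + 10)"
  proof -
    have "a\<^sub>2 - a\<^sub>4 = 2 / 3 * b * (3 * c\<^sub>1 - (c\<^sub>3 + 5 * b * c\<^sub>1 * c\<^sub>2 + of_real ((17 * \<beta>\<^sup>2 + 1) / 3) * c\<^sub>1 ^ 3))"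
      unfolding a\<^sub>2_def a\<^sub>4_def N by (simp add: algebra_simps)
    then have "cmod (a\<^sub>2 - a\<^sub>4) = 2 / 3 * \<beta> *
        cmod (3 * c\<^sub>1 - (c\<^sub>3 + 5 * b * c\<^sub>1 * c\<^sub>2 + of_real ((17 * \<beta>\<^sup>2 + 1) / 3) * c\<^sub>1 ^ 3))"
      by (simp only: norm_mult b) simp
    also have "\<dots> \<le> 2 / 3 * \<beta> * (3 + (17 * \<beta>\<^sup>2 + 1) / 3)"
    proof (intro mult_left_mono)
      have "cmod (3 * c\<^sub>1 - (c\<^sub>3 + 5 * b * c\<^sub>1 * c\<^sub>2 + of_real ((17 * \<beta>\<^sup>2 + 1) / 3) * c\<^sub>1 ^ 3))
          \<le> cmod (3 * c\<^sub>1) + (cmod c\<^sub>3 + cmod (5 * b * c\<^sub>1 * c\<^sub>2) + cmod (of_real ((17 * \<beta>\<^sup>2 + 1) / 3) * c\<^sub>1 ^ 3))"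
        by (intro norm_triangle_le_diff add_mono order_refl norm_triangle_le)
      also have "\<dots> = 3 * c + cmod c\<^sub>3 + 5 * \<beta> * c * cmod c\<^sub>2 + (17 * \<beta>\<^sup>2 + 1) / 3 * c ^ 3"
        unfolding norm_mult norm_power norm_of_real b c_def[symmetric] by simp
      also have "\<dots> \<le> 3 * c + (1 - c\<^sup>2) + 5 * \<beta> * c * (1 - c\<^sup>2) + (17 * \<beta>\<^sup>2 + 1) / 3 * c ^ 3"
        using c2 c3 c \<beta>0 by (intro add_mono mult_left_mono) auto
      also have "\<dots> \<le> 3 + (17 * \<beta>\<^sup>2 + 1) / 3" by (rule first_factor_real_bound[OF \<beta>0 c])
      finally show "cmod (3 * c\<^sub>1 - (c\<^sub>3 + 5 * b * c\<^sub>1 * c\<^sub>2 + of_real ((17 * \<beta>\<^sup>2 + 1) / 3) * c\<^sub>1 ^ 3))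
          \<le> 3 + (17 * \<beta>\<^sup>2 + 1) / 3" .
    qed (use \<beta>0 in simp)
    finally show ?thesis by (simp add: field_simps)
  qed
  moreover have "cmod (a\<^sub>2\<^sup>2 - 2 * a\<^sub>3\<^sup>2 + a\<^sub>2 * a\<^sub>4) \<le> 2 / 9 * \<beta>\<^sup>2 * (47 * \<beta>\<^sup>2 + 16)"
  proof -
    define E where "E = 2 * c\<^sub>1\<^sup>2 - c\<^sub>2\<^sup>2 - 8 / 3 * b * c\<^sub>1\<^sup>2 * c\<^sub>2 + 2 / 3 * c\<^sub>1 * c\<^sub>3 - of_real ((47 * \<beta>\<^sup>2 - 2) / 9) * c\<^sub>1 ^ 4"
    have "a\<^sub>2\<^sup>2 - 2 * a\<^sub>3\<^sup>2 + a\<^sub>2 * a\<^sub>4 = 2 * b\<^sup>2 * E"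
      unfolding a\<^sub>2_def a\<^sub>3_def a\<^sub>4_def E_def K[symmetric] by (simp add: field_simps) algebra
    then have "cmod (a\<^sub>2\<^sup>2 - 2 * a\<^sub>3\<^sup>2 + a\<^sub>2 * a\<^sub>4) = 2 * \<beta>\<^sup>2 * cmod E"
      by (simp only: norm_mult norm_power b) simp
    also have "\<dots> \<le> 2 * \<beta>\<^sup>2 * ((47 * \<beta>\<^sup>2 + 16) / 9)"
    proof (intro mult_left_mono)
      have "cmod E \<le> cmod (2 * c\<^sub>1\<^sup>2) + cmod (c\<^sub>2\<^sup>2) + cmod (8 / 3 * b * c\<^sub>1\<^sup>2 * c\<^sub>2) + cmod (2 / 3 * c\<^sub>1 * c\<^sub>3)
          + cmod (of_real ((47 * \<beta>\<^sup>2 - 2) / 9) * c\<^sub>1 ^ 4)"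
        unfolding E_def by (intro norm_triangle_le_diff norm_triangle_le add_mono order_refl)
      also have "\<dots> = 2 * c\<^sup>2 + (cmod c\<^sub>2)\<^sup>2 + 8 / 3 * \<beta> * c\<^sup>2 * cmod c\<^sub>2 + 2 / 3 * c * cmod c\<^sub>3
          + (47 * \<beta>\<^sup>2 - 2) / 9 * c ^ 4"
        unfolding norm_mult norm_power norm_of_real b c_def[symmetric] using K0 by (simp add: norm_divide)
      also have "\<dots> \<le> 2 * c\<^sup>2 + (1 - c\<^sup>2)\<^sup>2 + 8 / 3 * \<beta> * c\<^sup>2 * (1 - c\<^sup>2) + 2 / 3 * c * (1 - c\<^sup>2)
          + (47 * \<beta>\<^sup>2 - 2) / 9 * c ^ 4"
        using c2 c3 c \<beta>0 K0 by (intro add_mono mult_left_mono power_mono) auto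
      also have "\<dots> \<le> (47 * \<beta>\<^sup>2 + 16) / 9" by (rule second_factor_real_bound[OF \<beta> c])
      finally show "cmod E \<le> (47 * \<beta>\<^sup>2 + 16) / 9" .
    qed simp
    finally show ?thesis by simp
  qed
  ultimately have "cmod (toeplitz_det a\<^sub>2 a\<^sub>3 a\<^sub>4)
      \<le> (2 / 9 * \<beta> * (17 * \<beta>\<^sup>2 + 10)) * (2 / 9 * \<beta>\<^sup>2 * (47 * \<beta>\<^sup>2 + 16))"
    unfolding toeplitz_det_factor norm_mult using \<beta>0 by (intro mult_mono) auto
  also have "\<dots> = 4 / 81 * \<beta> ^ 3 * (17 * \<beta>\<^sup>2 + 10) * (47 * \<beta>\<^sup>2 + 16)"
    by (simp add: power2_eq_square power3_eq_cube)
  finally show ?thesis .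
qed

text \<open>The power \<open>q = p powr (1 / \<beta>)\<close> opens the sector to the right half-plane, and \<open>w = (q - 1) / (q + 1)\<close> maps
  the half-plane to the disc. The principal logarithm is holomorphic on the range of \<open>p\<close>, as the
  sector avoids the negative real axis.\<close>

lemma sector_Schwarz_function:
  assumes p: "p holomorphic_on ball 0 1" and p0: "p 0 = 1" and \<beta>: "0 < \<beta>" "\<beta> \<le> 1"
    and nz: "\<And>z. cmod z < 1 \<Longrightarrow> p z \<noteq> 0"
    and sector: "\<And>z. cmod z < 1 \<Longrightarrow> \<bar>Arg (p z)\<bar> < pi / 2 * \<beta>"
  obtains w where "w holomorphic_on ball 0 1" "w 0 = 0" "\<And>z. cmod z < 1 \<Longrightarrow> cmod (w z) < 1"
    "\<And>z. cmod z < 1 \<Longrightarrow> deriv p z * (1 - w z * w z) = 2 * of_real \<beta> * deriv w z * p z"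
proof -
  have slit: "p z \<notin> \<real>\<^sub>\<le>\<^sub>0" if z: "cmod z < 1" for z
  proof
    assume "p z \<in> \<real>\<^sub>\<le>\<^sub>0"
    then obtain r where "p z = of_real r" "r \<le> 0" by (auto simp: nonpos_Reals_def)
    then have "Arg (p z) = pi" using nz[OF z] Arg_of_real[of r] by auto
    moreover have "pi / 2 * \<beta> \<le> pi" using \<beta> pi_gt_zero mult_left_le[of \<beta> "pi / 2"] by linarith
    ultimately show False using sector[OF z] pi_gt_zero by simp
  qed
  define q where "q z = exp (Ln (p z) / of_real \<beta>)" for z
  have Req: "0 < Re (q z)" if z: "cmod z < 1" for z
  proof -
    have *: "\<bar>Im (Ln (p z) / of_real \<beta>)\<bar> < pi / 2"
      using sector[OF z] \<beta> Arg_eq_Im_Ln[OF nz[OF z]] by (simp add: field_simps)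
    have "0 < cos (Im (Ln (p z) / of_real \<beta>))"
      by (rule cos_gt_zero_pi) (use * in linarith)+
    then show ?thesis unfolding q_def Re_exp by simp
  qed
  have q1: "q z + 1 \<noteq> 0" if "cmod z < 1" for z
    using Req[OF that] by (auto simp: complex_eq_iff)
  define w where "w z = (q z - 1) / (q z + 1)" for z
  have qd: "(q has_field_derivative q z * (deriv p z / p z / of_real \<beta>)) (at z)" if z: "cmod z < 1" for z
  proof -
    have "(p has_field_derivative deriv p z) (at z)"
      using holomorphic_derivI[OF p] z by auto
    then show ?thesis unfolding q_def
      by (auto intro!: derivative_eq_intros simp: slit[OF z] nz[OF z] \<beta>(1)[THEN less_imp_neq, symmetric] divide_simps)
  qed
  have wd: "(w has_field_derivative 2 * (q z * (deriv p z / p z / of_real \<beta>)) / (q z + 1)\<^sup>2) (at z)"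
    if z: "cmod z < 1" for z
  proof -
    define D where "D = q z * (deriv p z / p z / of_real \<beta>)"
    have "(w has_field_derivative (D * (q z + 1) - (q z - 1) * D) / ((q z + 1) * (q z + 1))) (at z)"
      unfolding w_def
      by (rule DERIV_divide) (auto intro!: derivative_eq_intros qd[OF z] q1[OF z] simp: D_def)
    moreover have "D * (q z + 1) - (q z - 1) * D = 2 * D" by (simp add: algebra_simps)
    ultimately show ?thesis by (simp only: D_def power2_eq_square)
  qed
  have "w holomorphic_on ball 0 1"
    unfolding holomorphic_on_open[OF open_ball] using wd mem_ball_0 by blast
  moreover have "w 0 = 0" by (simp add: w_def q_def p0)
  moreover have "cmod (w z) < 1" if z: "cmod z < 1" for z
  proof -
    have "(cmod (q z - 1))\<^sup>2 < (cmod (q z + 1))\<^sup>2"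
      unfolding cmod_power2 using Req[OF z] by (simp add: power2_eq_square algebra_simps)
    then have "cmod (q z - 1) < cmod (q z + 1)" by (rule power_less_imp_less_base) simp
    then show ?thesis using q1[OF z] by (simp add: w_def norm_divide)
  qed
  moreover have "deriv p z * (1 - w z * w z) = 2 * of_real \<beta> * deriv w z * p z" if z: "cmod z < 1" for z
  proof -
    have "1 - w z * w z = 4 * q z / (q z + 1)\<^sup>2"
      using q1[OF z] by (simp add: w_def divide_simps power2_eq_square) (simp add: algebra_simps)
    then show ?thesis
      unfolding DERIV_imp_deriv[OF wd[OF z]] using \<beta> nz[OF z] q1[OF z] by (simp add: divide_simps)
  qed
  ultimately show ?thesis using that by blast
qed

theorem strongly_starlike_toeplitz_bound:
  assumes \<psi>: "\<psi> holomorphic_on ball 0 1" and \<psi>0: "\<psi> 0 = 1" and \<beta>: "1 / 2 \<le> \<beta>" "\<beta> \<le> 1"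
    and p: "p holomorphic_on ball 0 1" "\<And>z. cmod z < 1 \<Longrightarrow> \<psi> z + z * deriv \<psi> z = p z * \<psi> z"
    and nz: "\<And>z. cmod z < 1 \<Longrightarrow> p z \<noteq> 0"
    and sector: "\<And>z. cmod z < 1 \<Longrightarrow> \<bar>Arg (p z)\<bar> < pi / 2 * \<beta>"
    and S: "\<psi> has_fps_expansion S"
  shows "cmod (toeplitz_det (fps_nth S 1) (fps_nth S 2) (fps_nth S 3))
    \<le> 4 / 81 * \<beta> ^ 3 * (17 * \<beta>\<^sup>2 + 10) * (47 * \<beta>\<^sup>2 + 16)"
proof -
  have p0: "p 0 = 1" using p(2)[of 0] \<psi>0 by simp
  obtain w where w: "w holomorphic_on ball 0 1" "w 0 = 0" "\<And>z. cmod z < 1 \<Longrightarrow> cmod (w z) < 1"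
    "\<And>z. cmod z < 1 \<Longrightarrow> deriv p z * (1 - w z * w z) = 2 * of_real \<beta> * deriv w z * p z"
    using sector_Schwarz_function[OF p(1) p0 _ \<beta>(2) nz sector] \<beta>(1) by auto
  define W where "W = fps_expansion w 0"
  define P where "P = fps_expansion p 0"
  have W: "w has_fps_expansion W" unfolding W_def by (rule holomorphic_has_fps_expansion[OF w(1)])
  have P: "p has_fps_expansion P" unfolding P_def by (rule holomorphic_has_fps_expansion[OF p(1)])
  have PW: "fps_deriv P * (1 - W * W) = fps_const (2 * of_real \<beta>) * fps_deriv W * P"
    by (rule fps_expansions_eqI[OF
          has_fps_expansion_mult[OF has_fps_expansion_deriv[OF P]
            has_fps_expansion_diff[OF has_fps_expansion_1 has_fps_expansion_mult[OF W W]]]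
          has_fps_expansion_mult[OF has_fps_expansion_cmult_left[OF has_fps_expansion_deriv[OF W]] P]
          w(4)])
  have PS: "S + fps_X * fps_deriv S = P * S"
    by (rule fps_expansions_eqI[OF
          has_fps_expansion_add[OF S has_fps_expansion_mult[OF has_fps_expansion_fps_X
            has_fps_expansion_deriv[OF S]]]
          has_fps_expansion_mult[OF P S] p(2)])
  have c: "fps_nth P 0 = 1" "fps_nth W 0 = 0" "fps_nth S 0 = 1"
    using has_fps_expansion_imp_0_eq_fps_nth_0[OF P] has_fps_expansion_imp_0_eq_fps_nth_0[OF W]
      has_fps_expansion_imp_0_eq_fps_nth_0[OF S] p0 w(2) \<psi>0 by simp_all
  show ?thesis
    unfolding strongly_starlike_coeffs[OF c PW PS]
    by (rule toeplitz_det_bound[OF \<beta>(1) Schwarz_function_coeffs[OF w(1,2,3) W]])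
qed

text \<open>The equation is \<open>\<psi>' / \<psi> = (p - 1) / t\<close>, whose right-hand side has a removable singularity at \<open>0\<close>; \<open>\<psi>\<close> is the
  exponential of a primitive.\<close>

lemma solve_starlike_equation:
  assumes p: "p holomorphic_on ball 0 1" and p0: "p 0 = 1"
  obtains \<psi> where "\<psi> holomorphic_on ball 0 1" "\<psi> 0 = 1" "\<And>z. cmod z < 1 \<Longrightarrow> \<psi> z \<noteq> 0"
    "\<And>z. cmod z < 1 \<Longrightarrow> \<psi> z + z * deriv \<psi> z = p z * \<psi> z"
proof -
  have "(\<lambda>z. p z - 1) holomorphic_on ball 0 1" by (intro holomorphic_intros p)
  then obtain h where h: "h holomorphic_on ball 0 1" "\<And>z. cmod z < 1 \<Longrightarrow> p z - 1 = z * h z"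
    using Schwarz3[of "\<lambda>z. p z - 1" 1] p0 by auto
  obtain g where "\<And>z. z \<in> ball 0 1 \<Longrightarrow> (g has_field_derivative h z) (at z within ball 0 1)"
    using holomorphic_convex_primitive'[OF _ _ h(1)] by auto
  then have g: "(g has_field_derivative h z) (at z)" if "cmod z < 1" for z
    using that by (metis at_within_open mem_ball_0 open_ball)
  define \<psi> where "\<psi> z = exp (g z - g 0)" for z
  have d: "(\<psi> has_field_derivative \<psi> z * h z) (at z)" if "cmod z < 1" for z
    unfolding \<psi>_def by (auto intro!: derivative_eq_intros g that)
  have hol: "\<psi> holomorphic_on ball 0 1"
    unfolding holomorphic_on_open[OF open_ball] using d mem_ball_0 by blast
  have ode: "\<psi> z + z * deriv \<psi> z = p z * \<psi> z" if "cmod z < 1" for z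
    using h(2)[OF that] unfolding DERIV_imp_deriv[OF d[OF that]] by (simp add: algebra_simps)
  have "\<psi> 0 = 1" "\<And>z. \<psi> z \<noteq> 0" by (simp_all add: \<psi>_def)
  then show ?thesis using that[OF hol _ _ ode] by simp
qed

text \<open>The extremal Schwarz function is the rotation \<open>w(t) = \<i> t\<close>. With \<open>w(t) = t\<close> the coefficients \<open>A\<^sub>2, A\<^sub>3, A\<^sub>4\<close>
  would be positive, and \<open>A\<^sub>2 - A\<^sub>4\<close> would suffer cancellation; the factor \<open>\<i>\<close> gives \<open>A\<^sub>2\<close> and \<open>A\<^sub>4\<close>
  opposite arguments.\<close>

theorem strongly_starlike_toeplitz_sharp:
  assumes \<beta>: "0 < \<beta>" "\<beta> \<le> 1"
  obtains \<psi> p S where "\<psi> holomorphic_on ball 0 1" "\<psi> 0 = 1" "\<And>z. cmod z < 1 \<Longrightarrow> \<psi> z \<noteq> 0"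
    "\<And>z. cmod z < 1 \<Longrightarrow> \<psi> z + z * deriv \<psi> z = p z * \<psi> z"
    "\<And>z. cmod z < 1 \<Longrightarrow> p z \<noteq> 0"
    "\<And>z. cmod z < 1 \<Longrightarrow> \<bar>Arg (p z)\<bar> < pi / 2 * \<beta>"
    "\<psi> has_fps_expansion S"
    "cmod (toeplitz_det (fps_nth S 1) (fps_nth S 2) (fps_nth S 3))
      = 4 / 81 * \<beta> ^ 3 * (17 * \<beta>\<^sup>2 + 10) * (47 * \<beta>\<^sup>2 + 16)"
proof -
  define u where "u z = (1 + \<i> * z) / (1 - \<i> * z)" for z
  have den: "1 - \<i> * z \<noteq> 0" "1 + \<i> * z \<noteq> 0" if "cmod z < 1" for z
  proof -
    have "cmod (\<i> * z) \<noteq> cmod 1" using that by (simp add: norm_mult)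
    then show "1 - \<i> * z \<noteq> 0" by auto
    have "cmod (\<i> * z) \<noteq> cmod (-1)" using that by (simp add: norm_mult)
    then show "1 + \<i> * z \<noteq> 0" by (metis add_eq_0_iff)
  qed
  have Re: "0 < Re (u z)" if z: "cmod z < 1" for z
  proof -
    have "(Re z)\<^sup>2 + (Im z)\<^sup>2 < 1" using z by (simp add: cmod_def)
    then have "0 < Re ((1 + \<i> * z) * cnj (1 - \<i> * z))" by (simp add: power2_eq_square algebra_simps)
    moreover have "u z = (1 + \<i> * z) * cnj (1 - \<i> * z) / of_real ((cmod (1 - \<i> * z))\<^sup>2)"
      unfolding u_def complex_norm_square
      by (rule mult_divide_mult_cancel_right[symmetric]) (use den[OF z] in \<open>simp only: complex_cnj_zero_iff, simp\<close>)
    ultimately show ?thesis using den[OF z] by (simp add: zero_less_divide_iff)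
  qed
  have slit: "u z \<notin> \<real>\<^sub>\<le>\<^sub>0" if "cmod z < 1" for z
    using Re[OF that] by (auto simp: complex_nonpos_Reals_iff)
  define p where "p z = exp (of_real \<beta> * Ln (u z))" for z
  have ud: "(u has_field_derivative 2 * \<i> / (1 - \<i> * z)\<^sup>2) (at z)" if z: "cmod z < 1" for z
    unfolding u_def using den[OF z]
    by (auto intro!: derivative_eq_intros simp: power2_eq_square field_simps)
  have pd: "(p has_field_derivative p z * (of_real \<beta> * (2 * \<i> / (1 + z * z)))) (at z)" if z: "cmod z < 1" for z
  proof -
    have "(1 - \<i> * z) * (1 + \<i> * z) = 1 + z * z" by (simp add: algebra_simps)
    then have 1: "2 * \<i> / (1 - \<i> * z)\<^sup>2 / u z = 2 * \<i> / (1 + z * z)"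
      unfolding u_def using den[OF z] by (simp add: power2_eq_square divide_simps)
    have "(p has_field_derivative p z * (of_real \<beta> * (2 * \<i> / (1 - \<i> * z)\<^sup>2 / u z))) (at z)"
      unfolding p_def by (auto intro!: derivative_eq_intros ud[OF z] slit[OF z] simp: divide_simps)
    then show ?thesis unfolding 1 .
  qed
  have p: "p holomorphic_on ball 0 1"
    unfolding holomorphic_on_open[OF open_ball] using pd mem_ball_0 by blast
  have p0: "p 0 = 1" by (simp add: p_def u_def)
  have nz: "p z \<noteq> 0" for z by (simp add: p_def)
  have sector: "\<bar>Arg (p z)\<bar> < pi / 2 * \<beta>" if z: "cmod z < 1" for z
  proof -
    have Im: "\<bar>Im (Ln (u z))\<bar> < pi / 2" using Re[OF z] by (rule Re_Ln_pos_lt_imp)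
    have im: "Im (of_real \<beta> * Ln (u z)) = \<beta> * Im (Ln (u z))" by simp
    have b: "\<bar>\<beta> * Im (Ln (u z))\<bar> < pi / 2 * \<beta>" using Im \<beta>(1) by (simp add: abs_mult mult.commute)
    also have le: "pi / 2 * \<beta> \<le> pi / 2" using \<beta>(2) by (intro mult_left_le) auto
    finally have "Arg (p z) = \<beta> * Im (Ln (u z))"
      unfolding p_def by (subst Arg_exp) (use im pi_gt_zero in linarith)+
    then show ?thesis using b by simp
  qed
  obtain \<psi> where \<psi>: "\<psi> holomorphic_on ball 0 1" "\<psi> 0 = 1" "\<And>z. cmod z < 1 \<Longrightarrow> \<psi> z \<noteq> 0"
    "\<And>z. cmod z < 1 \<Longrightarrow> \<psi> z + z * deriv \<psi> z = p z * \<psi> z"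
    using solve_starlike_equation[OF p p0] by blast
  define S where "S = fps_expansion \<psi> 0"
  define P where "P = fps_expansion p 0"
  define W where "W = fps_const \<i> * fps_X"
  have S: "\<psi> has_fps_expansion S" unfolding S_def by (rule holomorphic_has_fps_expansion[OF \<psi>(1)])
  have P: "p has_fps_expansion P" unfolding P_def by (rule holomorphic_has_fps_expansion[OF p])
  have W: "(\<lambda>z. \<i> * z) has_fps_expansion W" unfolding W_def by (intro fps_expansion_intros)
  have ode: "deriv p z * (1 - (\<i> * z) * (\<i> * z)) = 2 * of_real \<beta> * deriv (\<lambda>z. \<i> * z) z * p z"
    if z: "cmod z < 1" for z
  proof -
    have "(1 - \<i> * z) * (1 + \<i> * z) = 1 + z * z" by (simp add: algebra_simps)
    then have "1 + z * z \<noteq> 0" using den[OF z] by (metis mult_eq_0_iff)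
    moreover have "1 - (\<i> * z) * (\<i> * z) = 1 + z * z" by (simp add: algebra_simps)
    moreover have "deriv (\<lambda>z. \<i> * z) z = \<i>" by simp
    ultimately show ?thesis unfolding DERIV_imp_deriv[OF pd[OF z]] by (simp add: field_simps)
  qed
  have PW: "fps_deriv P * (1 - W * W) = fps_const (2 * of_real \<beta>) * fps_deriv W * P"
    by (rule fps_expansions_eqI[OF
          has_fps_expansion_mult[OF has_fps_expansion_deriv[OF P]
            has_fps_expansion_diff[OF has_fps_expansion_1 has_fps_expansion_mult[OF W W]]]
          has_fps_expansion_mult[OF has_fps_expansion_cmult_left[OF has_fps_expansion_deriv[OF W]] P]
          ode])
  have PS: "S + fps_X * fps_deriv S = P * S"
    by (rule fps_expansions_eqI[OF
          has_fps_expansion_add[OF S has_fps_expansion_mult[OF has_fps_expansion_fps_X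
            has_fps_expansion_deriv[OF S]]]
          has_fps_expansion_mult[OF P S] \<psi>(4)])
  have c: "fps_nth P 0 = 1" "fps_nth W 0 = 0" "fps_nth S 0 = 1"
    using has_fps_expansion_imp_0_eq_fps_nth_0[OF P] has_fps_expansion_imp_0_eq_fps_nth_0[OF S] p0 \<psi>(2)
    by (simp_all add: W_def)
  have w: "fps_nth W 1 = \<i>" "fps_nth W 2 = 0" "fps_nth W 3 = 0"
    by (simp_all add: W_def numeral_2_eq_2 numeral_3_eq_3)
  have "toeplitz_det (fps_nth S 1) (fps_nth S 2) (fps_nth S 3)
      = - \<i> * of_real (4 / 81 * \<beta> ^ 3 * (17 * \<beta>\<^sup>2 + 10) * (47 * \<beta>\<^sup>2 + 16))"
    unfolding strongly_starlike_coeffs[OF c PW PS] w toeplitz_det_factor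
    by (simp add: power2_eq_square power3_eq_cube field_simps)
  then have "cmod (toeplitz_det (fps_nth S 1) (fps_nth S 2) (fps_nth S 3))
      = \<bar>4 / 81 * \<beta> ^ 3 * (17 * \<beta>\<^sup>2 + 10) * (47 * \<beta>\<^sup>2 + 16)\<bar>"
    by (simp only: norm_mult norm_of_real norm_minus_cancel norm_ii mult_1_left)
  then have "cmod (toeplitz_det (fps_nth S 1) (fps_nth S 2) (fps_nth S 3))
      = 4 / 81 * \<beta> ^ 3 * (17 * \<beta>\<^sup>2 + 10) * (47 * \<beta>\<^sup>2 + 16)"
    using \<beta> by (simp add: abs_of_nonneg)
  from that[OF \<psi> nz sector S this] show ?thesis by simp
qed

section \<open>Strongly starlike mappings along complex lines\<close>

lemma bounded_bilinear_scaleC: "bounded_bilinear (\<lambda>(c::complex) (x::'a::complex_normed_vector). c *\<^sub>C x)"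
proof
  fix a b :: complex and x y :: 'a and r :: real
  show "(a + b) *\<^sub>C x = a *\<^sub>C x + b *\<^sub>C x" by (rule scaleC_add_left)
  show "a *\<^sub>C (x + y) = a *\<^sub>C x + a *\<^sub>C y" by (rule scaleC_add_right)
  show "(r *\<^sub>R a) *\<^sub>C x = r *\<^sub>R a *\<^sub>C x"
    by (simp add: scaleR_conv_of_real scaleR_eq_scaleC[where 'a = 'a] scaleC_scaleC)
  show "a *\<^sub>C r *\<^sub>R x = r *\<^sub>R a *\<^sub>C x"
    by (simp add: scaleR_eq_scaleC[where 'a = 'a] scaleC_scaleC mult.commute)
  show "\<exists>K. \<forall>a x. norm (a *\<^sub>C (x::'a)) \<le> norm a * norm x * K"
    by (rule exI[of _ 1]) (simp add: norm_scaleC)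
qed

lemma fderiv_eqI:
  assumes "(f has_derivative D) (at z)"
  shows "blinfun_apply (fderiv f z) = D"
  unfolding fderiv_def frechet_derivative_at[OF assms, symmetric]
  by (rule bounded_linear_Blinfun_apply[OF has_derivative_bounded_linear[OF assms]])

lemma scalar_multiple_derivative:
  fixes f :: "'a::complex_normed_vector \<Rightarrow> complex"
  assumes f: "fholomorphic_on f S" and z: "z \<in> S"
  shows "((\<lambda>z. f z *\<^sub>C z) has_derivative (\<lambda>h. f z *\<^sub>C h + fderiv f z h *\<^sub>C z)) (at z)"
  by (rule bounded_bilinear.FDERIV[OF bounded_bilinear_scaleC has_derivative_fderiv(1)[OF f z] has_derivative_ident])

lemma fholomorphic_scalar_multiple:
  fixes f :: "'a::complex_normed_vector \<Rightarrow> complex"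
  assumes f: "fholomorphic_on f S"
  shows "fholomorphic_on (\<lambda>z. f z *\<^sub>C z) S"
  unfolding fholomorphic_on_def
proof
  fix z assume z: "z \<in> S"
  note D = scalar_multiple_derivative[OF f z]
  have "f z *\<^sub>C c *\<^sub>C h + fderiv f z (c *\<^sub>C h) *\<^sub>C z = c *\<^sub>C (f z *\<^sub>C h + fderiv f z h *\<^sub>C z)" for c h
    by (simp add: bounded_clinearD(3)[OF has_derivative_fderiv(2)[OF f z]] scaleC_complex_def
        scaleC_add_right scaleC_scaleC mult.commute)
  then show "\<exists>D. bounded_clinear D \<and> ((\<lambda>z. f z *\<^sub>C z) has_derivative D) (at z)"
    using D has_derivative_bounded_linear[OF D] unfolding bounded_clinear_def by blast
qed

text \<open>The line through \<open>z\<close> is invariant under \<open>DF(z)\<close>, so injectivity of \<open>DF(z)\<close> keeps the factor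
  \<open>f z + Df(z) z\<close> away from \<open>0\<close>, and \<open>[DF(z)]\<^sup>-\<^sup>1 F(z)\<close> is found on that line.\<close>

lemma starlike_quotient:
  fixes f :: "'a::complex_normed_vector \<Rightarrow> complex"
  assumes f: "fholomorphic_on f (ball 0 1)" and z: "z \<in> ball 0 1" "z \<noteq> 0"
    and inv: "G o\<^sub>L fderiv (\<lambda>z. f z *\<^sub>C z) z = id_blinfun"
  shows "f z + fderiv f z z \<noteq> 0"
    and "inv (blinfun_apply (fderiv (\<lambda>z. f z *\<^sub>C z) z)) (f z *\<^sub>C z) = (f z / (f z + fderiv f z z)) *\<^sub>C z"
proof -
  let ?D = "blinfun_apply (fderiv (\<lambda>z. f z *\<^sub>C z) z)"
  have D: "?D = (\<lambda>h. f z *\<^sub>C h + fderiv f z h *\<^sub>C z)"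
    by (rule fderiv_eqI[OF scalar_multiple_derivative[OF f z(1)]])
  have inj: "inj ?D"
    using inv by (intro inj_on_inverseI[of _ "blinfun_apply G"]) (metis blinfun_apply_blinfun_compose blinfun_apply_id_blinfun)
  have Dz: "?D (c *\<^sub>C z) = (c * (f z + fderiv f z z)) *\<^sub>C z" for c
    unfolding D by (simp add: bounded_clinearD(3)[OF has_derivative_fderiv(2)[OF f z(1)]]
        scaleC_complex_def scaleC_scaleC distrib_left scaleC_add_left mult.commute)
  show nz: "f z + fderiv f z z \<noteq> 0"
  proof
    assume "f z + fderiv f z z = 0"
    then have "?D z = ?D 0" using Dz[of 1] by (simp add: scaleC_one scaleC_zero_left blinfun.zero_right)
    then show False using injD[OF inj] z(2) by blast
  qed
  have "?D ((f z / (f z + fderiv f z z)) *\<^sub>C z) = f z *\<^sub>C z"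
    unfolding Dz using nz by simp
  then show "inv ?D (f z *\<^sub>C z) = (f z / (f z + fderiv f z z)) *\<^sub>C z"
    by (rule inv_f_eq[OF inj])
qed

text \<open>Passing to the inverse changes the sign of the principal argument, except on the real line, where it is
  unchanged.\<close>

lemma abs_Arg_swap:
  assumes "0 < r"
  shows "\<bar>Arg (a / b * of_real r)\<bar> = \<bar>Arg (b / a)\<bar>"
proof -
  have "Arg (a / b * of_real r) = Arg (a / b)"
    by (rule Arg_times_of_real2[OF assms])
  moreover have "\<bar>Arg (inverse (b / a))\<bar> = \<bar>Arg (b / a)\<bar>" by (subst Arg_inverse) simp
  ultimately show ?thesis by simp
qed

text \<open>The starlikeness condition at \<open>z\<close> does not depend on the choice of the support functional \<open>l\<close>, since \<open>l\<close> is
  evaluated at a multiple of \<open>z\<close>.\<close>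

lemma strongly_starlike_scalar_iff:
  fixes f :: "'a::complex_normed_vector \<Rightarrow> complex"
  assumes f: "fholomorphic_on f (ball 0 1)" and z: "z \<in> ball 0 1" "z \<noteq> 0"
    and inv: "G o\<^sub>L fderiv (\<lambda>z. f z *\<^sub>C z) z = id_blinfun" and l: "l \<in> support_functionals z"
  shows "(let w = l (inv (blinfun_apply (fderiv (\<lambda>z. f z *\<^sub>C z) z)) (f z *\<^sub>C z)) in w \<noteq> 0 \<and> \<bar>Arg w\<bar> < pi / 2 * \<beta>)
    \<longleftrightarrow> f z \<noteq> 0 \<and> \<bar>Arg ((f z + fderiv f z z) / f z)\<bar> < pi / 2 * \<beta>"
proof -
  have l': "bounded_clinear l" "l z = of_real (norm z)"
    using l by (auto simp: support_functionals_def)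
  note nz = starlike_quotient(1)[OF f z inv]
  have "l (inv (blinfun_apply (fderiv (\<lambda>z. f z *\<^sub>C z) z)) (f z *\<^sub>C z))
      = f z / (f z + fderiv f z z) * of_real (norm z)"
    unfolding starlike_quotient(2)[OF f z inv]
    by (simp add: bounded_clinearD(3)[OF l'(1)] l'(2) scaleC_complex_def)
  then show ?thesis
    using nz z(2) abs_Arg_swap[of "norm z" "f z" "f z + fderiv f z z"] by (cases "f z = 0") (auto simp: Let_def)
qed

text \<open>\<open>DF(z)\<close> is the multiple \<open>f z\<close> of the identity plus an operator of rank at most one, and the inverse is given by the
  Sherman--Morrison formula.\<close>

lemma scalar_multiple_derivative_invertible:
  fixes f :: "'a::complex_normed_vector \<Rightarrow> complex"
  assumes f: "fholomorphic_on f S" and z: "z \<in> S"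
    and nz: "f z \<noteq> 0" "f z + fderiv f z z \<noteq> 0"
  shows "\<exists>G. G o\<^sub>L fderiv (\<lambda>z. f z *\<^sub>C z) z = id_blinfun \<and> fderiv (\<lambda>z. f z *\<^sub>C z) z o\<^sub>L G = id_blinfun"
proof -
  let ?d = "blinfun_apply (fderiv f z)"
  define g where "g h = inverse (f z) *\<^sub>C (h - (?d h / (f z + ?d z)) *\<^sub>C z)" for h
  have d: "?d (c *\<^sub>C h) = c * ?d h" for c h
    by (simp add: bounded_clinearD(3)[OF has_derivative_fderiv(2)[OF f z]] scaleC_complex_def)
  have D: "blinfun_apply (fderiv (\<lambda>z. f z *\<^sub>C z) z) = (\<lambda>h. f z *\<^sub>C h + ?d h *\<^sub>C z)"
    by (rule fderiv_eqI[OF scalar_multiple_derivative[OF f z]])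
  have "bounded_linear g"
    unfolding g_def divide_inverse
    by (intro bounded_linear_compose[OF bounded_linear_scaleC] bounded_linear_sub bounded_linear_ident
        bounded_linear_compose[OF bounded_linear_scaleC_left] bounded_linear_mult_const blinfun.bounded_linear_right)
  then have G: "blinfun_apply (Blinfun g) = g" by (rule bounded_linear_Blinfun_apply)
  have "g (f z *\<^sub>C h + ?d h *\<^sub>C z) = h" for h
  proof -
    have "?d (f z *\<^sub>C h + ?d h *\<^sub>C z) / (f z + ?d z) = ?d h"
      using nz(2) by (simp add: blinfun.add_right d nonzero_divide_eq_eq algebra_simps)
    then show ?thesis using nz(1) by (simp add: g_def scaleC_scaleC scaleC_one)
  qed
  moreover have "f z *\<^sub>C g h + ?d (g h) *\<^sub>C z = h" for h
  proof -
    define c where "c = ?d h / (f z + ?d z)"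
    have "?d h = c * (f z + ?d z)" using nz(2) by (simp add: c_def)
    then have "?d (g h) = c"
      unfolding g_def c_def[symmetric] using nz(1) by (simp add: d blinfun.diff_right algebra_simps)
    then show ?thesis
      using nz(1) by (simp add: g_def c_def[symmetric] scaleC_scaleC scaleC_one)
  qed
  ultimately show ?thesis
    by (intro exI[of _ "Blinfun g"]) (auto intro!: blinfun_eqI simp: G D)
qed

text \<open>Along \<open>t \<mapsto> t *\<^sub>C u\<close> each further Frechet derivative, evaluated at \<open>u\<close>, is the ordinary derivative of the
  preceding one. So the \<open>n\<close>-th derivative at \<open>0\<close>, applied to \<open>(u, \<dots>, u)\<close> and \<open>l\<close>, is \<open>n!\<close> times a
  coefficient of \<open>l (F (t *\<^sub>C u)) = t * f (t *\<^sub>C u)\<close>; the factor \<open>t\<close> shifts the index by one.\<close>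

lemma Frechet_coeffs_eq_fps_coeffs:
  fixes f :: "'a::complex_banach \<Rightarrow> complex"
  assumes f: "fholomorphic_on f (ball 0 1)" and u: "norm u = 1" and l: "l \<in> support_functionals u"
    and S: "(\<lambda>t. f (t *\<^sub>C u)) has_fps_expansion S"
  shows "A2 (\<lambda>z. f z *\<^sub>C z) u l = fps_nth S 1" "A3 (\<lambda>z. f z *\<^sub>C z) u l = fps_nth S 2"
    "A4 (\<lambda>z. f z *\<^sub>C z) u l = fps_nth S 3"
proof -
  define F where "F = (\<lambda>z. f z *\<^sub>C z)"
  have l': "bounded_clinear l" "l u = 1" using l u by (auto simp: support_functionals_def)
  have bl: "bounded_linear l" using l'(1) by (simp add: bounded_clinear_def)
  have op: "open (ball (0::'a) 1)" by simp
  have F0: "fholomorphic_on F (ball 0 1)" unfolding F_def by (rule fholomorphic_scalar_multiple[OF f])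
  note F1 = fholomorphic_fderiv[OF op F0]
  note F2 = fholomorphic_fderiv[OF op F1]
  note F3 = fholomorphic_fderiv[OF op F2]
  have lapp: "bounded_clinear (\<lambda>T. k (blinfun_apply T u))" if "bounded_clinear k"
    for k :: "'b::complex_normed_vector \<Rightarrow> complex"
    using that unfolding bounded_clinear_def
    by (auto intro: bounded_linear_compose[OF _ bounded_linear_apply_blinfun] bounded_linear_ident
        simp: scaleC_blinfun.rep_eq)
  note l1 = lapp[OF l'(1)]
  note l2 = lapp[OF l1]
  note l3 = lapp[OF l2]
  have line: "0 + t *\<^sub>C u \<in> ball 0 1" if "cmod t < 1" for t
    using that u by (simp add: norm_scaleC)
  have step: "(\<lambda>t. k (fderiv H (t *\<^sub>C u) u)) has_fps_expansion fps_deriv A"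
    if H: "fholomorphic_on H (ball 0 1)" and k: "bounded_clinear k"
      and A: "(\<lambda>t. k (H (t *\<^sub>C u))) has_fps_expansion A"
    for H :: "'a \<Rightarrow> 'b::complex_normed_vector" and k A
  proof -
    have "deriv (\<lambda>t. k (H (t *\<^sub>C u))) t = k (fderiv H (t *\<^sub>C u) u)" if "cmod t < 1" for t
      using field_derivative_along_line[OF H line[OF that] k] by (simp add: DERIV_imp_deriv)
    then have "\<forall>\<^sub>F t in nhds 0. deriv (\<lambda>t. k (H (t *\<^sub>C u))) t = k (fderiv H (t *\<^sub>C u) u)"
      using eventually_nhds_in_open[of "ball 0 1" "0::complex"] by (auto elim!: eventually_mono)
    from iffD1[OF has_fps_expansion_cong[OF this refl] has_fps_expansion_deriv[OF A]]
    show ?thesis .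
  qed
  have "(\<lambda>t. t * f (t *\<^sub>C u)) has_fps_expansion fps_X * S"
    by (rule has_fps_expansion_mult[OF has_fps_expansion_fps_X S])
  moreover have "l (F (t *\<^sub>C u)) = t * f (t *\<^sub>C u)" for t
    by (simp add: F_def scaleC_scaleC bounded_clinearD(3)[OF l'(1)] scaleC_complex_def l'(2))
  ultimately have E0: "(\<lambda>t. l (F (t *\<^sub>C u))) has_fps_expansion fps_X * S" by simp
  note E1 = step[OF F0 l'(1) E0]
  note E2 = step[OF F1 l1 E1]
  note E3 = step[OF F2 l2 E2]
  note E4 = step[OF F3 l3 E3]
  show "A2 (\<lambda>z. f z *\<^sub>C z) u l = fps_nth S 1" "A3 (\<lambda>z. f z *\<^sub>C z) u l = fps_nth S 2"
    "A4 (\<lambda>z. f z *\<^sub>C z) u l = fps_nth S 3"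
    using has_fps_expansion_imp_0_eq_fps_nth_0[OF E2] has_fps_expansion_imp_0_eq_fps_nth_0[OF E3]
      has_fps_expansion_imp_0_eq_fps_nth_0[OF E4]
    unfolding A2_def A3_def A4_def F_def[symmetric]
    by (simp_all add: u scaleC_zero_left fact_numeral numeral_2_eq_2 numeral_3_eq_3)
qed

lemma support_functionals_normalize:
  assumes z: "z \<noteq> 0" and l: "l \<in> support_functionals z"
  shows "l \<in> support_functionals ((1 / norm z) *\<^sub>R z)"
proof -
  have "bounded_linear l" using l by (simp add: support_functionals_def bounded_clinear_def)
  then have "l ((1 / norm z) *\<^sub>R z) = (1 / norm z) *\<^sub>R l z"
    by (simp add: linear_simps bounded_linear.linear linear_cmul)
  then show ?thesis using l z by (simp add: support_functionals_def scaleR_conv_of_real)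
qed

lemma coeff_expr_normalize:
  fixes F :: "'a::complex_normed_vector \<Rightarrow> 'a"
  assumes z: "z \<noteq> 0" and l: "bounded_linear l"
  shows "coeff_expr F z l = coeff_expr F ((1 / norm z) *\<^sub>R z) l"
proof -
  define u where "u = (1 / norm z) *\<^sub>R z"
  have zu: "z = norm z *\<^sub>R u" and u: "norm u = 1" using z by (simp_all add: u_def)
  have r: "complex_of_real (norm z) \<noteq> 0" using z by simp
  have s: "l (r *\<^sub>R x) = of_real r * l x" for r x
    using bounded_linear.linear[OF l] by (simp add: linear_cmul scaleR_conv_of_real)
  have "A2 F z l = A2 F u l" unfolding A2_def
    by (subst (1 2) zu) (use r in \<open>simp add: blinfun.scaleR_right blinfun.scaleR_left s u power2_eq_square\<close>)
  moreover have "A3 F z l = A3 F u l" unfolding A3_def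
    by (subst (1 2 3) zu) (use r in \<open>simp add: blinfun.scaleR_right blinfun.scaleR_left s u power3_eq_cube\<close>)
  moreover have "A4 F z l = A4 F u l" unfolding A4_def
    by (subst (1 2 3 4) zu) (use r in \<open>simp add: blinfun.scaleR_right blinfun.scaleR_left s u power4_eq_xxxx\<close>)
  ultimately show ?thesis unfolding coeff_expr_def u_def by simp
qed

text \<open>The slice of \<open>f\<close> in the direction of \<open>z\<close> satisfies the hypotheses of the one-variable estimate. A support
  functional exists at each point of the slice, so the starlikeness condition can be used there.\<close>

theorem strongly_starlike_coeff_bound:
  fixes f :: "'a::complex_banach \<Rightarrow> complex"
  assumes \<beta>: "1 / 2 \<le> \<beta>" "\<beta> \<le> 1"
    and f: "fholomorphic_on f (ball 0 1)" "f 0 = 1" and F: "(\<lambda>z. f z *\<^sub>C z) \<in> strongly_starlike \<beta>"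
    and z: "z \<noteq> 0" and l: "l \<in> support_functionals z"
  shows "cmod (coeff_expr (\<lambda>z. f z *\<^sub>C z) z l) \<le> 4 / 81 * \<beta> ^ 3 * (17 * \<beta>\<^sup>2 + 10) * (47 * \<beta>\<^sup>2 + 16)"
proof -
  define u where "u = (1 / norm z) *\<^sub>R z"
  have u: "norm u = 1" using z by (simp add: u_def)
  have lu: "l \<in> support_functionals u" unfolding u_def by (rule support_functionals_normalize[OF z l])
  define \<psi> where "\<psi> t = f (t *\<^sub>C u)" for t
  have ball: "t *\<^sub>C u \<in> ball 0 1" if "cmod t < 1" for t
    using that u by (simp add: norm_scaleC)
  have id: "bounded_clinear (\<lambda>x::complex. x)"
    by (simp add: bounded_clinear_def bounded_linear_ident)
  have \<psi>': "(\<psi> has_field_derivative fderiv f (t *\<^sub>C u) u) (at t)" if "cmod t < 1" for t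
    using field_derivative_along_line[OF f(1) _ id, of 0 t u] ball[OF that] by (simp add: \<psi>_def[abs_def])
  have hol: "\<psi> holomorphic_on ball 0 1"
    unfolding holomorphic_on_open[OF open_ball] using \<psi>' mem_ball_0 by blast
  have \<psi>0: "\<psi> 0 = 1" by (simp add: \<psi>_def scaleC_zero_left f)
  define p where "p t = (\<psi> t + t * deriv \<psi> t) / \<psi> t" for t
  have p0: "p 0 = 1" by (simp add: p_def \<psi>0)
  have key: "\<psi> t \<noteq> 0 \<and> p t \<noteq> 0 \<and> \<bar>Arg (p t)\<bar> < pi / 2 * \<beta>" if t: "cmod t < 1" for t
  proof (cases "t = 0")
    case True
    have "0 < pi / 2 * \<beta>" using \<beta>(1) by simp
    then show ?thesis unfolding True \<psi>0 p0 by simp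
  next
    case False
    define x where "x = t *\<^sub>C u"
    have "norm x = cmod t" using u by (simp add: x_def norm_scaleC)
    then have x: "x \<in> ball 0 1" "x \<noteq> 0" using t False by auto
    obtain G where G: "G o\<^sub>L fderiv (\<lambda>z. f z *\<^sub>C z) x = id_blinfun"
      using F x(1) unfolding strongly_starlike_def locally_biholomorphic_def by blast
    obtain k where k: "k \<in> support_functionals x" using support_functionals_nonempty[OF x(2)] by blast
    have "f x \<noteq> 0 \<and> \<bar>Arg ((f x + fderiv f x x) / f x)\<bar> < pi / 2 * \<beta>"
      unfolding strongly_starlike_scalar_iff[OF f(1) x G k, symmetric]
      using F x k unfolding strongly_starlike_def by blast
    moreover have "p t = (f x + fderiv f x x) / f x"
      unfolding p_def DERIV_imp_deriv[OF \<psi>'[OF t]] \<psi>_def x_def[symmetric]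
      using bounded_clinearD(3)[OF has_derivative_fderiv(2)[OF f(1) x(1)], of t u]
      by (simp add: x_def scaleC_complex_def)
    ultimately show ?thesis
      using starlike_quotient(1)[OF f(1) x G] by (simp add: \<psi>_def x_def)
  qed
  have p: "p holomorphic_on ball 0 1"
    unfolding p_def using key by (intro holomorphic_intros holomorphic_deriv hol) auto
  have S: "\<psi> has_fps_expansion fps_expansion \<psi> 0" by (rule holomorphic_has_fps_expansion[OF hol])
  have "coeff_expr (\<lambda>z. f z *\<^sub>C z) z l = coeff_expr (\<lambda>z. f z *\<^sub>C z) u l"
    unfolding u_def using l by (intro coeff_expr_normalize[OF z]) (simp add: support_functionals_def bounded_clinear_def)
  also have "\<dots> = toeplitz_det (fps_nth (fps_expansion \<psi> 0) 1) (fps_nth (fps_expansion \<psi> 0) 2) (fps_nth (fps_expansion \<psi> 0) 3)"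
    unfolding coeff_expr_def toeplitz_det_def Frechet_coeffs_eq_fps_coeffs[OF f(1) u lu S[unfolded \<psi>_def[abs_def]]]
      \<psi>_def[abs_def] ..
  finally show ?thesis
    using strongly_starlike_toeplitz_bound[OF hol \<psi>0 \<beta> p _ _ _ S] key by (simp add: p_def)
qed

text \<open>Composing the extremal function \<open>\<psi>\<close> of one variable with a support functional \<open>l\<close> of a unit vector \<open>u\<close> gives
  \<open>f z + Df(z) z = p (l z) * f z\<close> on the whole unit ball, because \<open>\<bar>l z\<bar> < 1\<close> there. The slice of \<open>f\<close> in
  the direction \<open>u\<close> is \<open>\<psi>\<close> itself.\<close>

theorem strongly_starlike_coeff_sharp:
  assumes \<beta>: "0 < \<beta>" "\<beta> \<le> 1" and nontrivial: "\<exists>x::'a::complex_banach. x \<noteq> 0"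
  obtains f :: "'a::complex_banach \<Rightarrow> complex" and u l where "fholomorphic_on f (ball 0 1)" "f 0 = 1"
    "(\<lambda>z. f z *\<^sub>C z) \<in> strongly_starlike \<beta>" "u \<noteq> 0" "l \<in> support_functionals u"
    "cmod (coeff_expr (\<lambda>z. f z *\<^sub>C z) u l) = 4 / 81 * \<beta> ^ 3 * (17 * \<beta>\<^sup>2 + 10) * (47 * \<beta>\<^sup>2 + 16)"
proof -
  obtain x :: 'a where x: "x \<noteq> 0" using nontrivial by blast
  define u where "u = (1 / norm x) *\<^sub>R x"
  have u: "norm u = 1" using x by (simp add: u_def)
  then have u0: "u \<noteq> 0" by auto
  obtain l where l: "l \<in> support_functionals u" using support_functionals_nonempty[OF u0] by blast
  have l': "bounded_clinear l" "l u = 1" "onorm l = 1"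
    using l u by (auto simp: support_functionals_def)
  have bl: "bounded_linear l" using l'(1) by (simp add: bounded_clinear_def)
  have l_ball: "cmod (l z) < 1" if "z \<in> ball 0 1" for z
    using onorm[OF bl, of z] that l'(3) by simp
  obtain \<psi> p S where \<psi>: "\<psi> holomorphic_on ball 0 1" "\<psi> 0 = 1" "\<And>t. cmod t < 1 \<Longrightarrow> \<psi> t \<noteq> 0"
    and p: "\<And>t. cmod t < 1 \<Longrightarrow> \<psi> t + t * deriv \<psi> t = p t * \<psi> t" "\<And>t. cmod t < 1 \<Longrightarrow> p t \<noteq> 0"
      "\<And>t. cmod t < 1 \<Longrightarrow> \<bar>Arg (p t)\<bar> < pi / 2 * \<beta>"
    and S: "\<psi> has_fps_expansion S"
    and extremal: "cmod (toeplitz_det (fps_nth S 1) (fps_nth S 2) (fps_nth S 3))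
      = 4 / 81 * \<beta> ^ 3 * (17 * \<beta>\<^sup>2 + 10) * (47 * \<beta>\<^sup>2 + 16)"
    by (rule strongly_starlike_toeplitz_sharp[OF \<beta>]) (rule that)
  define f where "f z = \<psi> (l z)" for z
  have fd: "(f has_derivative (\<lambda>h. deriv \<psi> (l z) * l h)) (at z)" if z: "z \<in> ball 0 1" for z
  proof -
    have "(\<psi> has_field_derivative deriv \<psi> (l z)) (at (l z))"
      using holomorphic_derivI[OF \<psi>(1) open_ball] l_ball[OF z] by simp
    then show ?thesis unfolding f_def has_field_derivative_def
      by (rule has_derivative_compose[OF bounded_linear_imp_has_derivative[OF bl]])
  qed
  have f: "fholomorphic_on f (ball 0 1)"
    unfolding fholomorphic_on_def
  proof
    fix z :: 'a assume z: "z \<in> ball 0 1"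
    have "bounded_clinear (\<lambda>h. deriv \<psi> (l z) * l h)"
      unfolding bounded_clinear_def
      using has_derivative_bounded_linear[OF fd[OF z]]
      by (simp add: bounded_clinearD(3)[OF l'(1)] scaleC_complex_def)
    with fd[OF z] show "\<exists>D. bounded_clinear D \<and> (f has_derivative D) (at z)" by blast
  qed
  have l0: "l 0 = 0" by (rule bounded_clinearD(4)[OF l'(1)])
  have f0: "f 0 = 1" by (simp add: f_def l0 \<psi>(2))
  have nz: "f z \<noteq> 0" if "z \<in> ball 0 1" for z unfolding f_def by (rule \<psi>(3)[OF l_ball[OF that]])
  have fp: "f z + fderiv f z z = p (l z) * f z" if "z \<in> ball 0 1" for z
    using p(1)[OF l_ball[OF that]] unfolding fderiv_eqI[OF fd[OF that]] by (simp add: f_def mult.commute)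
  have inv: "\<exists>G. G o\<^sub>L fderiv (\<lambda>z. f z *\<^sub>C z) z = id_blinfun \<and> fderiv (\<lambda>z. f z *\<^sub>C z) z o\<^sub>L G = id_blinfun"
    if z: "z \<in> ball 0 1" for z
    by (rule scalar_multiple_derivative_invertible[OF f z nz[OF z]])
      (use fp[OF z] nz[OF z] p(2)[OF l_ball[OF z]] in simp)
  have "(\<lambda>z. f z *\<^sub>C z) \<in> strongly_starlike \<beta>"
    unfolding strongly_starlike_def mem_Collect_eq
  proof (intro conjI ballI)
    show "fholomorphic_on (\<lambda>z. f z *\<^sub>C z) (ball 0 1)" by (rule fholomorphic_scalar_multiple[OF f])
    have "fderiv (\<lambda>z. f z *\<^sub>C z) 0 = id_blinfun"
      by (rule blinfun_eqI)
        (simp add: fderiv_eqI[OF scalar_multiple_derivative[OF f]] f0 scaleC_one scaleC_zero_right)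
    then show "normalized (\<lambda>z. f z *\<^sub>C z)" by (simp add: normalized_def scaleC_zero_right)
    show "locally_biholomorphic (\<lambda>z. f z *\<^sub>C z)" unfolding locally_biholomorphic_def using inv by blast
    fix z k assume z: "z \<in> ball (0::'a) 1 - {0}" and k: "k \<in> support_functionals z"
    then have z': "z \<in> ball 0 1" "z \<noteq> 0" by auto
    obtain G where G: "G o\<^sub>L fderiv (\<lambda>z. f z *\<^sub>C z) z = id_blinfun" using inv[OF z'(1)] by blast
    show "let w = k (inv (blinfun_apply (fderiv (\<lambda>z. f z *\<^sub>C z) z)) (f z *\<^sub>C z)) in w \<noteq> 0 \<and> \<bar>Arg w\<bar> < pi / 2 * \<beta>"
      unfolding strongly_starlike_scalar_iff[OF f z' G k] fp[OF z'(1)]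
      using nz[OF z'(1)] p(3)[OF l_ball[OF z'(1)]] by simp
  qed
  moreover have "f (t *\<^sub>C u) = \<psi> t" for t
    by (simp add: f_def bounded_clinearD(3)[OF l'(1)] l'(2) scaleC_complex_def)
  then have "(\<lambda>t. f (t *\<^sub>C u)) has_fps_expansion S" using S by simp
  then have "coeff_expr (\<lambda>z. f z *\<^sub>C z) u l = toeplitz_det (fps_nth S 1) (fps_nth S 2) (fps_nth S 3)"
    unfolding coeff_expr_def toeplitz_det_def by (simp only: Frechet_coeffs_eq_fps_coeffs[OF f u l])
  ultimately show ?thesis using that[OF f f0 _ u0 l] extremal by simp
qed

theorem corollary5p3:
  fixes \<beta> \<beta>\<^sub>0 :: real
  assumes "\<exists>x::'a::complex_banach. x \<noteq> 0"
    and "\<beta>\<^sub>0 = (8 + sqrt 346) / 47"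
    and "\<beta> \<in> {\<beta>\<^sub>0..1}"
  shows "47 * \<beta>\<^sub>0\<^sup>2 - 16 * \<beta>\<^sub>0 - 6 = 0 \<and>
    (\<forall>f :: 'a \<Rightarrow> complex.
       fholomorphic_on f (ball 0 1) \<and> f 0 = 1 \<and> (\<lambda>z. f z *\<^sub>C z) \<in> strongly_starlike \<beta> \<longrightarrow>
       (\<forall>z l. z \<noteq> 0 \<and> l \<in> support_functionals z \<longrightarrow>
          cmod (coeff_expr (\<lambda>z. f z *\<^sub>C z) z l)
            \<le> 4 / 81 * \<beta> ^ 3 * (17 * \<beta>\<^sup>2 + 10) * (47 * \<beta>\<^sup>2 + 16))) \<and>
    (\<exists>f :: 'a \<Rightarrow> complex.
       fholomorphic_on f (ball 0 1) \<and> f 0 = 1 \<and> (\<lambda>z. f z *\<^sub>C z) \<in> strongly_starlike \<beta> \<and>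
       (\<exists>z l. z \<noteq> 0 \<and> l \<in> support_functionals z \<and>
          cmod (coeff_expr (\<lambda>z. f z *\<^sub>C z) z l)
            = 4 / 81 * \<beta> ^ 3 * (17 * \<beta>\<^sup>2 + 10) * (47 * \<beta>\<^sup>2 + 16)))"
proof -
  have "18 \<le> sqrt 346" by (rule real_le_rsqrt) simp
  then have \<beta>: "1 / 2 \<le> \<beta>" "0 < \<beta>" "\<beta> \<le> 1" using assms(2,3) by auto
  have "47 * \<beta>\<^sub>0\<^sup>2 - 16 * \<beta>\<^sub>0 - 6 = 0"
    unfolding assms(2) by (simp add: power2_eq_square field_simps)
  moreover have "cmod (coeff_expr (\<lambda>z. f z *\<^sub>C z) z l) \<le> 4 / 81 * \<beta> ^ 3 * (17 * \<beta>\<^sup>2 + 10) * (47 * \<beta>\<^sup>2 + 16)"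
    if "fholomorphic_on f (ball 0 1) \<and> f 0 = 1 \<and> (\<lambda>z. f z *\<^sub>C z) \<in> strongly_starlike \<beta>"
      and "z \<noteq> 0 \<and> l \<in> support_functionals z" for f :: "'a \<Rightarrow> complex" and z l
    using that by (intro strongly_starlike_coeff_bound[OF \<beta>(1,3)]) simp_all
  moreover obtain f :: "'a \<Rightarrow> complex" and u l where "fholomorphic_on f (ball 0 1)" "f 0 = 1"
    "(\<lambda>z. f z *\<^sub>C z) \<in> strongly_starlike \<beta>" "u \<noteq> 0" "l \<in> support_functionals u"
    "cmod (coeff_expr (\<lambda>z. f z *\<^sub>C z) u l) = 4 / 81 * \<beta> ^ 3 * (17 * \<beta>\<^sup>2 + 10) * (47 * \<beta>\<^sup>2 + 16)"
    by (rule strongly_starlike_coeff_sharp[OF \<beta>(2,3) assms(1)])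
  ultimately show ?thesis
    by (intro conjI allI impI exI[of _ f] exI[of _ u] exI[of _ l]) simp_all
qed

end
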